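(* $1234\sim_{\mathcal I}3214$; that is, for every $n$, the number of involutions in $\mathcal{S}_n$ avoiding $1234$ equals the number of involutions in $\mathcal{S}_n$ avoiding $3214$.
   Context: A permutation $\pi=\pi_1\ldots\pi_n\in\mathcal{S}_n$ avoids $\sigma\in\mathcal{S}_k$ if there is no subsequence $\pi_{i_1}\ldots\pi_{i_k}$, $i_1<\cdots<i_k$, whose order-preserving relabelling by $1,\dots,k$ is $\sigma$. $\mathcal{I}_n(\sigma)$ denotes the number of involutions in $\mathcal{S}_n$ (permutations whose square is the identity) which avoid $\sigma$. Write $\sigma\sim_{\mathcal I}\sigma'$ if $\mathcal{I}_n(\sigma)=\mathcal{I}_n(\sigma')$ for every $n$. *)

theory Defs
  imports "HOL-Library.Sublist" "HOL-Combinatorics.Permutations"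
begin

definition one_line :: "nat \<Rightarrow> (nat \<Rightarrow> nat) \<Rightarrow> nat list"
  where "one_line n \<pi> = map \<pi> [1..<Suc n]"

text \<open>For a word \<open>w\<close> with \<open>k\<close> distinct letters, \<open>v \<mapsto> card {u \<in> set w. u \<le> v}\<close> is the unique
  order-preserving bijection from its letters onto \<open>{1..k}\<close>.\<close>

definition relabel :: "nat list \<Rightarrow> nat list"
  where "relabel w = map (\<lambda>v. card {u \<in> set w. u \<le> v}) w"

lemma relabel_order_preserving:
  fixes w :: "nat list"
  assumes "distinct w"
  shows "strict_mono_on (set w) (\<lambda>v. card {u \<in> set w. u \<le> v})"
    and "bij_betw (\<lambda>v. card {u \<in> set w. u \<le> v}) (set w) {1..length w}"
proof -
  let ?f = "\<lambda>v. card {u \<in> set w. u \<le> v}"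
  show mono: "strict_mono_on (set w) ?f"
  proof (rule strict_mono_onI, rule psubset_card_mono)
    fix r s assume "r \<in> set w" "s \<in> set w" "r < s"
    moreover from this have "s \<in> {u \<in> set w. u \<le> s} - {u \<in> set w. u \<le> r}" by simp
    ultimately show "{u \<in> set w. u \<le> r} \<subset> {u \<in> set w. u \<le> s}" by fastforce
  qed simp
  have inj: "inj_on ?f (set w)"
    using mono by (rule strict_mono_on_imp_inj_on)
  have "?f ` set w \<subseteq> {1..length w}"
  proof
    fix y assume "y \<in> ?f ` set w"
    then obtain v where v: "v \<in> set w" "y = ?f v" by blast
    have "1 \<le> ?f v" using v(1) by (auto simp: Suc_le_eq card_gt_0_iff)
    moreover have "?f v \<le> card (set w)" by (rule card_mono) auto
    ultimately show "y \<in> {1..length w}"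
      unfolding v(2) atLeastAtMost_iff distinct_card[OF assms] by (rule conjI)
  qed
  moreover have "card (?f ` set w) = card {1..length w}"
    using card_image[OF inj] distinct_card[OF assms] by simp
  ultimately have "?f ` set w = {1..length w}"
    by (intro card_subset_eq) auto
  with inj show "bij_betw ?f (set w) {1..length w}"
    by (simp add: bij_betw_def)
qed

text \<open>Patterns are given in one-line notation. Subsequences (\<open>subseq\<close>) need not be contiguous.\<close>

definition avoids :: "nat \<Rightarrow> (nat \<Rightarrow> nat) \<Rightarrow> nat list \<Rightarrow> bool"
  where "avoids n \<pi> \<sigma> \<longleftrightarrow> \<not> (\<exists>w. subseq w (one_line n \<pi>) \<and> relabel w = \<sigma>)"

definition avoiding_involutions :: "nat \<Rightarrow> nat list \<Rightarrow> (nat \<Rightarrow> nat) set"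
  where "avoiding_involutions n \<sigma> = {\<pi>. \<pi> permutes {1..n} \<and> \<pi> \<circ> \<pi> = id \<and> avoids n \<pi> \<sigma>}"

definition invol_equiv :: "nat list \<Rightarrow> nat list \<Rightarrow> bool"  (infix "\<sim>\<^sub>I" 50)
  where "\<sigma> \<sim>\<^sub>I \<sigma>' \<longleftrightarrow>
    (\<forall>n. card (avoiding_involutions n \<sigma>) = card (avoiding_involutions n \<sigma>'))"

end

theory Submission
  imports Defs
begin

text \<open>Let \<open>P\<close> be the graph of an involution, \<open>F\<close> the board of all cells strictly south-west of a point of
  \<open>P\<close>, and \<open>T\<close> the set of points of \<open>P\<close> in \<open>F\<close>; the other points are the right-to-left maxima. The
  board \<open>F\<close> is determined by these maxima, and \<open>P\<close> contains \<open>1234\<close> (\<open>3214\<close>) iff \<open>T\<close> contains \<open>123\<close>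
  (\<open>321\<close>) inside some rectangle contained in \<open>F\<close>. So it suffices to exchange the fillings \<open>T\<close> of \<open>F\<close>
  avoiding \<open>123\<close> and those avoiding \<open>321\<close>, respecting the occupied rows and columns and the
  reflection in the diagonal. To a filling avoiding \<open>321\<close> attach at each vertex of the border of \<open>F\<close> the
  number of points to the south-west together with the length of their longest increasing chain; to
  one avoiding \<open>123\<close> the number of points and the length of the longest decreasing chain. These are
  the border shapes of Fomin's growth diagrams, with at most two rows and at most two columns
  respectively. Removing the corners of \<open>F\<close> one by one shows that in both cases the filling is
  determined by its border labels, and that the same label sequences occur. By uniqueness, the
  filling with the same labels as a symmetric filling is symmetric.\<close>

section \<open>Chains in partial placements\<close>

definition ne :: "nat \<times> nat \<Rightarrow> nat \<times> nat \<Rightarrow> bool"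
  where "ne p q \<longleftrightarrow> fst p < fst q \<and> snd p < snd q"

definition se :: "nat \<times> nat \<Rightarrow> nat \<times> nat \<Rightarrow> bool"
  where "se p q \<longleftrightarrow> fst p < fst q \<and> snd q < snd p"

definition placement :: "(nat \<times> nat) set \<Rightarrow> bool"
  where "placement S \<longleftrightarrow> inj_on fst S \<and> inj_on snd S"

definition chain :: "('a \<Rightarrow> 'a \<Rightarrow> bool) \<Rightarrow> 'a set \<Rightarrow> bool"
  where "chain r C \<longleftrightarrow> (\<forall>p\<in>C. \<forall>q\<in>C. p \<noteq> q \<longrightarrow> r p q \<or> r q p)"

definition max_chain :: "('a \<Rightarrow> 'a \<Rightarrow> bool) \<Rightarrow> 'a set \<Rightarrow> nat"
  where "max_chain r S = Max (card ` {C. C \<subseteq> S \<and> chain r C})"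

definition no_chain3 :: "('a \<Rightarrow> 'a \<Rightarrow> bool) \<Rightarrow> 'a set \<Rightarrow> bool"
  where "no_chain3 r S \<longleftrightarrow> \<not> (\<exists>p\<in>S. \<exists>q\<in>S. \<exists>s\<in>S. r p q \<and> r q s)"

text \<open>When \<open>S\<close> has no \<open>r\<close>-chain of length 3, the growth diagram puts the shape with the two parts
  \<open>d \<ge> m - d\<close> at the upper right corner of a rectangle with points \<open>S\<close>, where \<open>(m, d) = label r' S\<close> for the opposite relation \<open>r'\<close>.
  \<open>admissible\<close> says that \<open>(m, d)\<close> encodes such a shape, \<open>grow\<close> that at most one cell is added.\<close>

definition label :: "('a \<Rightarrow> 'a \<Rightarrow> bool) \<Rightarrow> 'a set \<Rightarrow> nat \<times> nat"
  where "label r S = (card S, max_chain r S)"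

text \<open>Cells are indexed by their lower left vertices, so the cells of \<open>box a b\<close> are those to the
  south-west of the vertex \<open>(a, b)\<close>.\<close>

definition box :: "nat \<Rightarrow> nat \<Rightarrow> (nat \<times> nat) set"
  where "box a b = {..<a} \<times> {..<b}"

lemma in_box [simp]: "(x, y) \<in> box a b \<longleftrightarrow> x < a \<and> y < b"
  by (simp add: box_def)

lemma finite_box [simp]: "finite (box a b)"
  by (simp add: box_def)

lemma placement_subset: "placement S \<Longrightarrow> T \<subseteq> S \<Longrightarrow> placement T"
  unfolding placement_def by (meson inj_on_subset)

lemma placement_fstD: "placement S \<Longrightarrow> (x, y) \<in> S \<Longrightarrow> (x, z) \<in> S \<Longrightarrow> y = z"
  unfolding placement_def by (metis inj_onD fst_conv snd_conv)

lemma placement_sndD: "placement S \<Longrightarrow> (x, y) \<in> S \<Longrightarrow> (z, y) \<in> S \<Longrightarrow> x = z"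
  unfolding placement_def by (metis inj_onD fst_conv snd_conv)

lemma placement_cases:
  assumes "placement S" "p \<in> S" "q \<in> S" "p \<noteq> q"
  shows "ne p q \<or> ne q p \<or> se p q \<or> se q p"
proof -
  have "fst p \<noteq> fst q" "snd p \<noteq> snd q"
    using assms unfolding placement_def by (metis inj_onD)+
  then show ?thesis unfolding ne_def se_def by linarith
qed

lemma no_chain3_subset: "no_chain3 r S \<Longrightarrow> T \<subseteq> S \<Longrightarrow> no_chain3 r T"
  unfolding no_chain3_def by blast

lemma no_chain3_empty: "no_chain3 r {}"
  by (simp add: no_chain3_def)

lemma chain_subset: "chain r C \<Longrightarrow> B \<subseteq> C \<Longrightarrow> chain r B"
  unfolding chain_def by blast

section \<open>Longest chains\<close>

lemma card_le_max_chain: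
  assumes "finite S" "C \<subseteq> S" "chain r C"
  shows "card C \<le> max_chain r S"
  unfolding max_chain_def using assms by (intro Max_ge) auto

lemma max_chain_attained:
  assumes "finite S"
  obtains C where "C \<subseteq> S" "chain r C" "card C = max_chain r S" "finite C"
proof -
  have "max_chain r S \<in> card ` {C. C \<subseteq> S \<and> chain r C}"
    unfolding max_chain_def using assms
    by (intro Max_in) (auto simp: chain_def intro!: exI[of _ "{}"])
  then obtain C where "C \<subseteq> S" "chain r C" "card C = max_chain r S" by auto
  then show ?thesis using that assms finite_subset by blast
qed

lemma max_chain_le_card:
  assumes "finite S"
  shows "max_chain r S \<le> card S"
proof -
  obtain C where C: "C \<subseteq> S" "chain r C" "card C = max_chain r S" "finite C"
    using assms by (rule max_chain_attained)
  show ?thesis using card_mono[OF assms C(1)] C(3) by simp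
qed

lemma max_chain_mono:
  assumes "finite S" "T \<subseteq> S"
  shows "max_chain r T \<le> max_chain r S"
proof -
  have "finite T" using assms finite_subset by blast
  then obtain C where C: "C \<subseteq> T" "chain r C" "card C = max_chain r T" "finite C"
    by (rule max_chain_attained)
  show ?thesis using card_le_max_chain[OF assms(1) _ C(2)] C(1,3) assms(2) by simp
qed

lemma max_chain_insert_le:
  assumes "finite S"
  shows "max_chain r (insert x S) \<le> Suc (max_chain r S)"
proof -
  obtain C where C: "C \<subseteq> insert x S" "chain r C" "card C = max_chain r (insert x S)" "finite C"
    using assms by (auto intro: max_chain_attained[of "insert x S" r])
  have "card (C - {x}) \<le> max_chain r S"
    using C by (intro card_le_max_chain assms) (auto intro: chain_subset)
  then show ?thesis using C by (simp add: card_Diff_singleton_if split: if_splits)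
qed

section \<open>Labels and their growth\<close>

lemma label_empty: "label r {} = (0, 0)"
  using max_chain_le_card[of "{}" r] by (simp add: label_def)

definition admissible :: "nat \<times> nat \<Rightarrow> bool"
  where "admissible l \<longleftrightarrow> snd l \<le> fst l \<and> fst l \<le> 2 * snd l"

definition grow :: "nat \<times> nat \<Rightarrow> nat \<times> nat \<Rightarrow> bool"
  where "grow k l \<longleftrightarrow> l = k \<or> fst l = Suc (fst k) \<and> (snd l = snd k \<or> snd l = Suc (snd k))"

lemma grow_refl: "grow k k"
  by (simp add: grow_def)

text \<open>Split \<open>S\<close> into the points with an \<open>r\<close>-predecessor and those
  without. An \<open>r\<close>-comparable pair in the first part would extend to a chain of length
  3, and the second part has no such pair. So both parts are \<open>r'\<close>-chains, and the
  larger one has at least half of the points.\<close>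

lemma admissible_label:
  assumes "finite S" "no_chain3 r S"
    and cmp: "\<And>p q. p \<in> S \<Longrightarrow> q \<in> S \<Longrightarrow> p \<noteq> q \<Longrightarrow> r p q \<or> r q p \<or> r' p q \<or> r' q p"
  shows "admissible (label r' S)"
proof -
  let ?A = "{p\<in>S. \<exists>q\<in>S. r q p}"
  have "chain r' ?A" "chain r' (S - ?A)"
    using assms(2) cmp unfolding chain_def no_chain3_def by blast+
  then have "card ?A \<le> max_chain r' S" "card (S - ?A) \<le> max_chain r' S"
    using assms(1) by (auto intro!: card_le_max_chain)
  moreover have "card S = card ?A + card (S - ?A)"
    using assms(1) by (metis (no_types, lifting) card_Diff_subset card_mono finite_subset
      le_add_diff_inverse mem_Collect_eq subsetI)
  ultimately show ?thesis
    using max_chain_le_card[OF assms(1)] by (auto simp: admissible_def label_def)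
qed

lemma grow_label_insert: "finite S \<Longrightarrow> grow (label r S) (label r (insert x S))"
  using max_chain_insert_le[of S r x] max_chain_mono[of "insert x S" S r]
  by (cases "x \<in> S") (auto simp: grow_def label_def insert_absorb subset_insertI)

section \<open>Points in the last row and column of a rectangle\<close>

lemma placement_column:
  assumes "placement S"
  obtains x where "S \<inter> box (Suc a) b = insert x (S \<inter> box a b)"
     | "S \<inter> box (Suc a) b = S \<inter> box a b"
proof (cases "\<exists>y<b. (a, y) \<in> S")
  case True
  then obtain y where y: "y < b" "(a, y) \<in> S" by blast
  have *: "(a, z) \<in> S \<longleftrightarrow> z = y" for z using y placement_fstD[OF assms y(2)] by metis
  have "S \<inter> box (Suc a) b = insert (a, y) (S \<inter> box a b)"
    using y(1) by (auto simp: less_Suc_eq *)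
  then show ?thesis using that by blast
next
  case False
  then have "S \<inter> box (Suc a) b = S \<inter> box a b" by (auto simp: less_Suc_eq)
  then show ?thesis using that by blast
qed

lemma placement_row:
  assumes "placement S"
  obtains x where "S \<inter> box a (Suc b) = insert x (S \<inter> box a b)"
     | "S \<inter> box a (Suc b) = S \<inter> box a b"
proof (cases "\<exists>y<a. (y, b) \<in> S")
  case True
  then obtain y where y: "y < a" "(y, b) \<in> S" by blast
  have *: "(z, b) \<in> S \<longleftrightarrow> z = y" for z using y placement_sndD[OF assms y(2)] by metis
  have "S \<inter> box a (Suc b) = insert (y, b) (S \<inter> box a b)"
    using y(1) by (auto simp: less_Suc_eq *)
  then show ?thesis using that by blast
next
  case False
  then have "S \<inter> box a (Suc b) = S \<inter> box a b" by (auto simp: less_Suc_eq)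
  then show ?thesis using that by blast
qed

lemma grow_column: "placement S \<Longrightarrow> grow (label r (S \<inter> box a b)) (label r (S \<inter> box (Suc a) b))"
  by (rule placement_column[of S a b]) (auto simp: grow_label_insert grow_refl)

lemma grow_row: "placement S \<Longrightarrow> grow (label r (S \<inter> box a b)) (label r (S \<inter> box a (Suc b)))"
  by (rule placement_row[of S a b]) (auto simp: grow_label_insert grow_refl)

text \<open>The local rules are checked in these four configurations. If row \<open>j\<close> and
  column \<open>i\<close> are both empty, the case is \<open>row_empty\<close>; hence row
  \<open>j\<close> is occupied in \<open>col_empty\<close>, and the two labels there have different
  cardinalities.\<close>

lemma corner_cases:
  assumes S: "placement S" "S \<subseteq> box (Suc i) (Suc j)"
  obtains (full) "(i, j) \<in> S" "S \<inter> box (Suc i) j = S \<inter> box i j" "S \<inter> box i (Suc j) = S \<inter> box i j"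
      "S = insert (i, j) (S \<inter> box i j)"
  | (row_empty) "(i, j) \<notin> S" "S \<inter> box i (Suc j) = S \<inter> box i j" "S \<inter> box (Suc i) j = S"
  | (col_empty) "(i, j) \<notin> S" "S \<inter> box (Suc i) j = S \<inter> box i j" "S \<inter> box i (Suc j) = S"
      "label r (S \<inter> box i j) \<noteq> label r S"
  | (both) c d where "(i, j) \<notin> S" "c < i" "d < j" "(c, j) \<in> S" "(i, d) \<in> S"
      "S \<inter> box (Suc i) j = insert (i, d) (S \<inter> box i j)"
      "S \<inter> box i (Suc j) = insert (c, j) (S \<inter> box i j)"
      "S = insert (i, d) (insert (c, j) (S \<inter> box i j))"
proof -
  have bd: "a < i \<or> a = i" "b < j \<or> b = j" if "(a, b) \<in> S" for a b
    using S(2) that by (auto simp: less_Suc_eq)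
  show ?thesis
  proof (cases "(i, j) \<in> S")
    case True
    have *: "(i, y) \<in> S \<longleftrightarrow> y = j" for y using placement_fstD[OF S(1) True] True by metis
    have **: "(x, j) \<in> S \<longleftrightarrow> x = i" for x using placement_sndD[OF S(1) True] True by metis
    have "S \<inter> box (Suc i) j = S \<inter> box i j" "S \<inter> box i (Suc j) = S \<inter> box i j"
      "S = insert (i, j) (S \<inter> box i j)"
      by (auto simp: less_Suc_eq * **) (metis bd * **)+
    then show ?thesis using full True by blast
  next
    case no: False
    show ?thesis
    proof (cases "\<exists>c. (c, j) \<in> S")
      case False
      then have "S \<inter> box i (Suc j) = S \<inter> box i j" "S \<inter> box (Suc i) j = S"
        by (auto simp: less_Suc_eq) (metis bd)+
      then show ?thesis using row_empty no by blast
    next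
      case True
      then obtain c where c: "(c, j) \<in> S" by blast
      have **: "(x, j) \<in> S \<longleftrightarrow> x = c" for x using placement_sndD[OF S(1) c] c by metis
      have "c < i" using S(2) c no by (metis in_box less_SucE subsetD)
      have fin: "finite S" using S(2) finite_subset finite_box by blast
      show ?thesis
      proof (cases "\<exists>d. (i, d) \<in> S")
        case False
        then have 1: "S \<inter> box (Suc i) j = S \<inter> box i j" "S \<inter> box i (Suc j) = S"
          by (auto simp: less_Suc_eq) (metis bd)+
        have "(c, j) \<notin> S \<inter> box i j" by simp
        then have "S \<inter> box i j \<subset> S" using c by blast
        then have "card (S \<inter> box i j) < card S" using fin by (simp add: psubset_card_mono)
        then show ?thesis using col_empty 1 no by (simp add: label_def)
      next
        case True
        then obtain d where d: "(i, d) \<in> S" by blast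
        have *: "(i, x) \<in> S \<longleftrightarrow> x = d" for x using placement_fstD[OF S(1) d] d by metis
        have "d < j" using S(2) d no by (metis in_box less_SucE subsetD)
        then have "S \<inter> box (Suc i) j = insert (i, d) (S \<inter> box i j)"
          "S \<inter> box i (Suc j) = insert (c, j) (S \<inter> box i j)"
          "S = insert (i, d) (insert (c, j) (S \<inter> box i j))"
          using \<open>c < i\<close> no by (auto simp: less_Suc_eq * **) (metis bd * **)+
        then show ?thesis using both no c d \<open>c < i\<close> \<open>d < j\<close> by blast
      qed
    qed
  qed
qed

lemma max_chain_two_incomparable:
  assumes "finite R" "x \<noteq> y" "\<not> r x y" "\<not> r y x"
  shows "max_chain r (insert x (insert y R)) = max (max_chain r (insert x R)) (max_chain r (insert y R))"
proof (rule antisym)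
  have "finite (insert x (insert y R))" using assms(1) by simp
  then obtain C where C: "C \<subseteq> insert x (insert y R)" "chain r C"
      "card C = max_chain r (insert x (insert y R))" "finite C"
    by (rule max_chain_attained)
  have "\<not> (x \<in> C \<and> y \<in> C)" using C(2) assms unfolding chain_def by blast
  then have "C \<subseteq> insert x R \<or> C \<subseteq> insert y R" using C(1) by blast
  then show "max_chain r (insert x (insert y R)) \<le>
    max (max_chain r (insert x R)) (max_chain r (insert y R))"
    using card_le_max_chain[OF _ _ C(2)] assms(1) C(3)
      by (metis finite_insert max.coboundedI1 max.coboundedI2)
next
  show "max (max_chain r (insert x R)) (max_chain r (insert y R)) \<le> max_chain r (insert x (insert y R))"
    using assms(1) by (intro max.boundedI max_chain_mono) auto
qed

lemma max_chain_less_insertI: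
  assumes "finite R" "C \<subseteq> R" "chain r (insert x C)" "x \<notin> C" "card C = max_chain r R"
  shows "max_chain r R < max_chain r (insert x R)"
proof -
  have "card (insert x C) \<le> max_chain r (insert x R)"
    using assms by (intro card_le_max_chain) auto
  moreover have "card (insert x C) = Suc (card C)"
    using assms finite_subset by (metis card_insert_disjoint)
  ultimately show ?thesis using assms(5) by simp
qed

lemma max_chain_insertE:
  assumes "finite R" "max_chain r R < max_chain r (insert x R)"
  obtains C where "C \<subseteq> R" "chain r (insert x C)" "x \<notin> C" "card C = max_chain r R"
proof -
  have "finite (insert x R)" using assms(1) by simp
  then obtain C where C: "C \<subseteq> insert x R" "chain r C" "card C = max_chain r (insert x R)" "finite C"
    by (rule max_chain_attained)
  have x: "x \<in> C"
  proof (rule ccontr)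
    assume "x \<notin> C"
    then have "card C \<le> max_chain r R" using C assms by (intro card_le_max_chain) auto
    then show False using C assms by simp
  qed
  have "card (C - {x}) = max_chain r R"
    using C x max_chain_insert_le[OF assms(1), of r x] assms(2) by simp
  moreover have "insert x (C - {x}) = C" using x by blast
  ultimately show ?thesis using that[of "C - {x}"] C by auto
qed

section \<open>One new point in the last column and one in the top row\<close>

locale two_points =
  fixes R :: "(nat \<times> nat) set" and i j c d :: nat
  assumes pl: "placement (insert (i, d) (insert (c, j) R))"
    and box: "R \<subseteq> box i j" and cd: "c < i" "d < j"
begin

lemma fin: "finite R"
  using box finite_subset finite_box by blast

lemma notin: "(i, d) \<notin> R" "(c, j) \<notin> R"
  using box by auto

lemma in_R:
  assumes "(a, b) \<in> R" shows "a < i" "b < j" "a \<noteq> c" "b \<noteq> d"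
proof -
  show "a < i" "b < j" using assms box by auto
  show "a \<noteq> c" using placement_fstD[OF pl, of c j b] assms \<open>b < j\<close> by auto
  show "b \<noteq> d" using placement_sndD[OF pl, of i d a] assms \<open>a < i\<close> by auto
qed

lemma R_bounds:
  assumes "w \<in> R"
  shows "fst w < i" "snd w < j" "fst w \<noteq> c" "snd w \<noteq> d"
  using in_R[of "fst w" "snd w"] assms by simp_all

lemma R_cases:
  assumes "p \<in> R" "q \<in> R" "p \<noteq> q"
  shows "ne p q \<or> ne q p \<or> se p q \<or> se q p"
  using placement_cases[OF pl, of p q] assms by blast

lemma max_chain_ne_both:
  "max_chain ne (insert (i, d) (insert (c, j) R)) =
    max (max_chain ne (insert (i, d) R)) (max_chain ne (insert (c, j) R))"
  using cd by (intro max_chain_two_incomparable fin) (auto simp: ne_def)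

text \<open>A point of \<open>R\<close> right of column \<open>c\<close> and above row
  \<open>d\<close> would lie between \<open>(c, j)\<close> and \<open>(i, d)\<close> in a decreasing
  chain. So a longest increasing chain with a point above row \<open>d\<close> stays left of column
  \<open>c\<close> and is extended by \<open>(c, j)\<close>; any other is extended by
  \<open>(i, d)\<close>.\<close>

lemma ne_grows:
  assumes "no_chain3 se (insert (i, d) (insert (c, j) R))"
  shows "max_chain ne R < max_chain ne (insert (i, d) R) \<or> max_chain ne R < max_chain ne (insert (c, j) R)"
proof -
  obtain C where C: "C \<subseteq> R" "chain ne C" "card C = max_chain ne R" "finite C"
    using fin by (rule max_chain_attained)
  have no: "fst z < c \<or> snd z < d" if "z \<in> R" for z
  proof (rule ccontr)
    obtain a b where z: "z = (a, b)" by fastforce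
    assume "\<not> ?thesis"
    then have "se (c, j) z" "se z (i, d)" using in_R[of a b] that z by (auto simp: se_def)
    then show False using assms that unfolding no_chain3_def by blast
  qed
  show ?thesis
  proof (cases "\<exists>z\<in>C. d < snd z")
    case True
    then obtain z where z: "z \<in> C" "d < snd z" by blast
    have "fst w < c" if w: "w \<in> C" for w
    proof -
      have "w = z \<or> ne w z \<or> ne z w" using C(2) w z unfolding chain_def by blast
      then show ?thesis using no[of w] no[of z] z w C(1) by (auto simp: ne_def)
    qed
    then have "chain ne (insert (c, j) C)"
      using C in_R(2) by (force simp: chain_def ne_def)
    then show ?thesis using max_chain_less_insertI[OF fin C(1)] C notin by blast
  next
    case False
    then have "chain ne (insert (i, d) C)"
      using C in_R(1,4) by (force simp: chain_def ne_def)
    then show ?thesis using max_chain_less_insertI[OF fin C(1)] C notin by blast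
  qed
qed

text \<open>A converse of \<open>ne_grows\<close>. A new decreasing chain of length 3 could only run
  from \<open>(c, j)\<close> through some \<open>q\<close> in \<open>R\<close> to
  \<open>(i, d)\<close>.\<close>

lemma no_chain3_se_both:
  assumes av: "no_chain3 se (insert (i, d) R)" "no_chain3 se (insert (c, j) R)"
    and gr: "max_chain ne R < max_chain ne (insert (i, d) R) \<or>
      max_chain ne R < max_chain ne (insert (c, j) R)"
  shows "no_chain3 se (insert (i, d) (insert (c, j) R))"
proof (rule ccontr)
  assume "\<not> ?thesis"
  then obtain p q s where pqs: "p \<in> insert (i, d) (insert (c, j) R)" "q \<in> insert (i, d) (insert (c, j) R)"
    "s \<in> insert (i, d) (insert (c, j) R)" "se p q" "se q s"
    unfolding no_chain3_def by blast
  have bd: "fst w < i" "snd w < j" if "w \<in> R" for w using R_bounds[OF that] by simp_all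
  have nx: "\<not> se (i, d) w" if "w \<in> insert (i, d) (insert (c, j) R)" for w
    using that cd bd by (fastforce simp: se_def)
  have ny: "\<not> se w (c, j)" if "w \<in> insert (i, d) (insert (c, j) R)" for w
    using that cd bd by (fastforce simp: se_def)
  have q: "q \<in> R" using pqs nx ny by blast
  have p: "p = (c, j)"
  proof (rule ccontr)
    assume "p \<noteq> (c, j)"
    then have "p \<in> R" "s \<in> insert (i, d) R" using pqs nx ny by blast+
    then show False using av(1) q pqs(4,5) unfolding no_chain3_def by blast
  qed
  have s: "s = (i, d)"
  proof (rule ccontr)
    assume "s \<noteq> (i, d)"
    then have "s \<in> R" using pqs nx ny by blast
    then show False using av(2) q p pqs(4,5) unfolding no_chain3_def by blast
  qed
  show False
    using gr
  proof
    assume gr: "max_chain ne R < max_chain ne (insert (i, d) R)"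
    obtain C where C: "C \<subseteq> R" "chain ne (insert (i, d) C)" "(i, d) \<notin> C" "card C = max_chain ne R"
      using fin gr by (rule max_chain_insertE)
    have low: "snd t < d" if "t \<in> C" for t
      using C(2,3) that bd[of t] C(1) unfolding chain_def ne_def by fastforce
    have "q \<notin> C" using low[of q] pqs(5) s by (auto simp: se_def)
    \<comment> \<open>\<open>C\<close> lies below row \<open>d\<close> and \<open>q\<close> above
      it. By maximality \<open>q\<close> cannot be added to \<open>C\<close>, so some
      \<open>t\<close> of \<open>C\<close> is south-east of \<open>q\<close>, and
      \<open>(c, j)\<close>, \<open>q\<close>, \<open>t\<close> is a forbidden chain without
      \<open>(i, d)\<close>.\<close>
    have "\<not> chain ne (insert q C)"
      using max_chain_less_insertI[OF fin C(1) _ \<open>q \<notin> C\<close> C(4)] q by (auto simp: insert_absorb)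
    then obtain t where t: "t \<in> C" "\<not> ne t q" "\<not> ne q t"
      using C(2) unfolding chain_def by blast
    then have "se q t" using R_cases[of q t] q C(1) low[of t] pqs(5) s \<open>q \<notin> C\<close>
      by (auto simp: se_def)
    then show False using av(2) q p pqs(4) t C(1) unfolding no_chain3_def by blast
  next
    assume gr: "max_chain ne R < max_chain ne (insert (c, j) R)"
    obtain C where C: "C \<subseteq> R" "chain ne (insert (c, j) C)" "(c, j) \<notin> C" "card C = max_chain ne R"
      using fin gr by (rule max_chain_insertE)
    have low: "fst t < c" if "t \<in> C" for t
      using C(2,3) that bd[of t] C(1) unfolding chain_def ne_def by fastforce
    have "q \<notin> C" using low[of q] pqs(4) p by (auto simp: se_def)
    have "\<not> chain ne (insert q C)"
      using max_chain_less_insertI[OF fin C(1) _ \<open>q \<notin> C\<close> C(4)] q by (auto simp: insert_absorb)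
    then obtain t where t: "t \<in> C" "\<not> ne t q" "\<not> ne q t"
      using C(2) unfolding chain_def by blast
    then have "se t q" using R_cases[of q t] q C(1) low[of t] pqs(4) p \<open>q \<notin> C\<close>
      by (auto simp: se_def)
    then show False using av(1) q s pqs(5) t C(1) unfolding no_chain3_def by blast
  qed
qed

text \<open>Nothing lies north-east of a new point, so a new point can only end an increasing chain,
  and no such chain contains both.\<close>

lemma no_chain3_ne_both:
  assumes av: "no_chain3 ne (insert (i, d) R)" "no_chain3 ne (insert (c, j) R)"
  shows "no_chain3 ne (insert (i, d) (insert (c, j) R))"
proof (rule ccontr)
  let ?S = "insert (i, d) (insert (c, j) R)"
  assume "\<not> ?thesis"
  then obtain p q s where pqs: "p \<in> ?S" "q \<in> ?S" "s \<in> ?S" "ne p q" "ne q s"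
    unfolding no_chain3_def by blast
  have bd: "fst w < i" "snd w < j" if "w \<in> R" for w using R_bounds[OF that] by simp_all
  have nx: "\<not> ne (i, d) w" "\<not> ne (c, j) w" if "w \<in> ?S" for w
    using that cd bd by (fastforce simp: ne_def)+
  have "p \<in> R" "q \<in> R" using pqs nx by blast+
  then show False using pqs(3,4,5) av unfolding no_chain3_def by blast
qed

text \<open>Cut both maximal chains at the place where the first one passes from below to above the second
  one, and exchange their tails: one of the two new chains lies in \<open>R\<close>, so the other one is long.\<close>

lemma se_both_grow:
  assumes "max_chain se R < max_chain se (insert (i, d) R)"
    "max_chain se R < max_chain se (insert (c, j) R)"
  shows "max_chain se (insert (i, d) (insert (c, j) R)) = Suc (Suc (max_chain se R))"
proof (rule antisym)
  show "max_chain se (insert (i, d) (insert (c, j) R)) \<le> Suc (Suc (max_chain se R))"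
    using max_chain_insert_le fin by (meson finite_insert le_trans not_less_eq_eq)
  obtain E where E: "E \<subseteq> R" "chain se (insert (i, d) E)" "(i, d) \<notin> E" "card E = max_chain se R"
    using fin assms(1) by (rule max_chain_insertE)
  obtain C where C: "C \<subseteq> R" "chain se (insert (c, j) C)" "(c, j) \<notin> C" "card C = max_chain se R"
    using fin assms(2) by (rule max_chain_insertE)
  define E' where "E' = insert (i, d) E"
  define C' where "C' = insert (c, j) C"
  \<comment> \<open>\<open>U\<close> holds the points of the first chain weakly south-west of a
    point of the second, \<open>V\<close> those below all of \<open>U\<close>. The cut is made at
    the highest point \<open>f\<close> of \<open>V\<close>, which exists because
    \<open>(i, d)\<close> is in \<open>V\<close>.\<close>
  define U where "U = {e \<in> E'. \<exists>v\<in>C'. fst e \<le> fst v \<and> snd e \<le> snd v}"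
  define V where "V = {e \<in> E'. \<forall>u\<in>U. snd e < snd u}"
  have bd: "fst w < i" "snd w < j" if "w \<in> R" for w using R_bounds[OF that] by simp_all
  have finE: "finite E'" "finite C'" using E(1) C(1) fin finite_subset by (auto simp: E'_def C'_def)
  have low: "d < snd e" if "e \<in> E" for e
    using E(2,3) that bd[of e] E(1) unfolding chain_def se_def by fastforce
  have rig: "c < fst e" if "e \<in> C" for e
    using C(2,3) that bd[of e] C(1) unfolding chain_def se_def by fastforce
  have xU: "(i, d) \<notin> U"
    using cd bd C(1) by (force simp: U_def C'_def)
  have "(i, d) \<in> V"
    using xU low by (force simp: V_def E'_def U_def)
  moreover have "finite V" using finE by (simp add: V_def)
  ultimately have "Max (snd ` V) \<in> snd ` V" by (intro Max_in) auto
  then obtain f where f1: "f \<in> V" "snd f = Max (snd ` V)" by auto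
  have "snd v \<le> snd f" if "v \<in> V" for v
    using that \<open>finite V\<close> f1(2) by simp
  note f = f1(1) this
  have fU: "f \<notin> U" using f(1) by (auto simp: V_def)
  have fE: "f \<in> E'" using f(1) by (simp add: V_def)
  have E'R: "E' \<subseteq> insert (i, d) R" and C'R: "C' \<subseteq> insert (c, j) R"
    using E C by (auto simp: E'_def C'_def)
  have chE: "chain se E'" and chC: "chain se C'" using E C by (auto simp: E'_def C'_def)
  define Et where "Et = {e \<in> E'. snd f < snd e}"
  define Eb where "Eb = {e \<in> E'. snd e \<le> snd f}"
  define Ct where "Ct = {e \<in> C'. snd f \<le> snd e}"
  define Cb where "Cb = {e \<in> C'. snd e < snd f}"
  have d_le: "d \<le> snd f" "snd f < j"
    using fE low[of f] cd bd(2)[of f] E(1) by (auto simp: E'_def less_imp_le)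
  have fC: "fst v < fst f" "snd f < snd v" if "v \<in> Ct" for v
  proof -
    have v: "v \<in> C'" "snd f \<le> snd v" using that by (auto simp: Ct_def)
    then show 1: "fst v < fst f" using fU fE by (auto simp: U_def not_le)
    have "v \<in> insert (i, d) (insert (c, j) R)" "f \<in> insert (i, d) (insert (c, j) R)"
      using v fE E'R C'R by auto
    then have "snd v \<noteq> snd f" using pl 1 unfolding placement_def by (metis inj_onD less_irrefl)
    then show "snd f < snd v" using v by simp
  qed
  have Eb_right: "fst f \<le> fst e" if "e \<in> Eb" for e
  proof -
    have "e = f \<or> se e f \<or> se f e" using chE fE that unfolding chain_def Eb_def by blast
    then show ?thesis using that by (auto simp: Eb_def se_def)
  qed
  have 1: "chain se (Ct \<union> Eb)"
  proof -
    have "se v e" if "v \<in> Ct" "e \<in> Eb" for v e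
      using fC[OF that(1)] Eb_right[OF that(2)] that by (auto simp: se_def Eb_def)
    moreover have "chain se Ct" "chain se Eb"
      using chE chC by (auto intro: chain_subset simp: Ct_def Eb_def)
    ultimately show ?thesis unfolding chain_def by blast
  qed
  have 2: "chain se (Et \<union> Cb)"
  proof -
    have "se e v" if ev: "e \<in> Et" "v \<in> Cb" for v e
    proof -
      \<comment> \<open>Being above the highest point of \<open>V\<close>, \<open>e\<close> is
        weakly above some \<open>u\<close> of \<open>U\<close>, which is weakly south-west of some
        \<open>w\<close> of the second chain. So \<open>e\<close> is weakly left of
        \<open>w\<close>, while \<open>v\<close>, lower than \<open>w\<close>, is to the right of
        it.\<close>
      have "e \<notin> V" using f(2)[of e] ev by (auto simp: Et_def)
      then obtain u where u: "u \<in> U" "snd u \<le> snd e" using ev by (auto simp: V_def Et_def not_less)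
      then obtain w where w: "w \<in> C'" "fst u \<le> fst w" "snd u \<le> snd w" by (auto simp: U_def)
      have "snd f < snd u" using f(1) u by (auto simp: V_def)
      then have "se w v" using chC w(1,3) ev unfolding chain_def Cb_def se_def by fastforce
      moreover have "u = e \<or> se u e \<or> se e u" using chE u ev unfolding chain_def U_def Et_def by blast
      ultimately show ?thesis using u w ev by (auto simp: se_def Et_def Cb_def)
    qed
    moreover have "chain se Et" "chain se Cb"
      using chE chC by (auto intro: chain_subset simp: Et_def Cb_def)
    ultimately show ?thesis unfolding chain_def by blast
  qed
  have dis: "Ct \<inter> Eb = {}" "Et \<inter> Cb = {}" "Et \<inter> Eb = {}" "Ct \<inter> Cb = {}"
    using fC by (force simp: Eb_def Et_def Ct_def Cb_def)+
  have un: "E' = Et \<union> Eb" "C' = Ct \<union> Cb" by (auto simp: Eb_def Et_def Ct_def Cb_def)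
  have fins: "finite Et" "finite Eb" "finite Ct" "finite Cb"
    using finE by (auto simp: Eb_def Et_def Ct_def Cb_def)
  have "card E' = card Et + card Eb" "card C' = card Ct + card Cb"
    unfolding un using dis fins by (auto intro: card_Un_disjoint)
  moreover have "card (Ct \<union> Eb) = card Ct + card Eb" "card (Et \<union> Cb) = card Et + card Cb"
    using dis fins by (auto intro: card_Un_disjoint)
  moreover have "card E' = Suc (max_chain se R)" "card C' = Suc (max_chain se R)"
    using E C finE by (auto simp: E'_def C'_def)
  \<comment> \<open>The cut leaves \<open>(i, d)\<close> in \<open>Eb\<close> and
    \<open>(c, j)\<close> in \<open>Ct\<close>, so this chain lies in \<open>R\<close>. Both new
    chains have \<open>2 * Suc (max_chain se R)\<close> points together, so the other one gets two
    more than the maximum of \<open>R\<close>.\<close>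
  moreover have "card (Et \<union> Cb) \<le> max_chain se R"
  proof (rule card_le_max_chain[OF fin _ 2])
    have "(i, d) \<notin> Et" "(c, j) \<notin> Cb" using d_le by (auto simp: Et_def Cb_def)
    then show "Et \<union> Cb \<subseteq> R" using E'R C'R by (auto simp: Et_def Cb_def)
  qed
  moreover have "card (Ct \<union> Eb) \<le> max_chain se (insert (i, d) (insert (c, j) R))"
    using E'R C'R by (intro card_le_max_chain[OF _ _ 1]) (auto simp: fin Ct_def Eb_def)
  ultimately show "Suc (Suc (max_chain se R)) \<le> max_chain se (insert (i, d) (insert (c, j) R))"
    by linarith
qed

text \<open>If \<open>R\<close> were smaller, the long chain \<open>G\<close> through both new points and a maximal chain of \<open>R\<close> would
  share a point; exchanging tails there contradicts the maximality.\<close>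

lemma se_both_bound:
  assumes "max_chain se (insert (i, d) (insert (c, j) R)) = Suc (max_chain se R)"
    "max_chain se (insert (i, d) R) = max_chain se R" "max_chain se (insert (c, j) R) = max_chain se R"
  shows "2 * max_chain se R \<le> Suc (card R)"
proof (rule ccontr)
  let ?p = "max_chain se R"
  assume less: "\<not> ?thesis"
  have "finite (insert (i, d) (insert (c, j) R))" using fin by simp
  then obtain G where G': "G \<subseteq> insert (i, d) (insert (c, j) R)" "chain se G"
      "card G = max_chain se (insert (i, d) (insert (c, j) R))" "finite G"
    by (rule max_chain_attained)
  note G = G'(1,2) G'(3)[unfolded assms(1)] G'(4)
  obtain E where E: "E \<subseteq> R" "chain se E" "card E = ?p" "finite E"
    using fin by (rule max_chain_attained)
  have bd: "fst w < i" "snd w < j" if "w \<in> R" for w using R_bounds[OF that] by simp_all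
  have x: "(i, d) \<in> G"
  proof (rule ccontr)
    assume "\<not> ?thesis"
    then have "G \<subseteq> insert (c, j) R" using G(1) by blast
    then show False using card_le_max_chain[of "insert (c, j) R" G se] fin G assms by simp
  qed
  have y: "(c, j) \<in> G"
  proof (rule ccontr)
    assume "\<not> ?thesis"
    then have "G \<subseteq> insert (i, d) R" using G(1) by blast
    then show False using card_le_max_chain[of "insert (i, d) R" G se] fin G assms by simp
  qed
  define H where "H = G - {(i, d), (c, j)}"
  have HR: "H \<subseteq> R" using G by (auto simp: H_def)
  \<comment> \<open>\<open>H\<close> and \<open>E\<close> have \<open>2 * ?p - 1\<close> points in
    total, by \<open>less\<close> more than \<open>R\<close> has, so they meet.\<close>
  have "card H = ?p - 1"
    using x y G cd by (simp add: H_def card_Diff_subset)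
  moreover have "card (H \<union> E) \<le> card R" using HR E fin by (intro card_mono) auto
  moreover have "card (H \<union> E) = card H + card E" if "H \<inter> E = {}"
    using that G E by (intro card_Un_disjoint) (auto simp: H_def)
  ultimately have "H \<inter> E \<noteq> {}" using less E by linarith
  then obtain e where e: "e \<in> H" "e \<in> E" by blast
  then have eG: "e \<in> G" and eR: "e \<in> R" using HR by (auto simp: H_def)
  define Gt where "Gt = {g \<in> G. snd e \<le> snd g}"
  define Gb where "Gb = {g \<in> G. snd g < snd e}"
  define Et where "Et = {g \<in> E. snd e \<le> snd g}"
  define Eb where "Eb = {g \<in> E. snd g < snd e}"
  have left: "fst g \<le> fst e" if "g \<in> Gt \<union> Et" for g
  proof -
    have "g = e \<or> se g e \<or> se e g" using G(2) E(2) eG e(2) that unfolding chain_def Gt_def Et_def by blast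
    then show ?thesis using that by (auto simp: se_def Gt_def Et_def)
  qed
  have right: "fst e < fst g" if "g \<in> Gb \<union> Eb" for g
  proof -
    have "g = e \<or> se g e \<or> se e g" using G(2) E(2) eG e(2) that unfolding chain_def Gb_def Eb_def by blast
    then show ?thesis using that by (auto simp: se_def Gb_def Eb_def)
  qed
  have cross: "se g h" if "g \<in> Gt \<union> Et" "h \<in> Gb \<union> Eb" for g h
    using left[OF that(1)] right[OF that(2)] that by (auto simp: se_def Gt_def Gb_def Et_def Eb_def)
  have "chain se Gt" "chain se Gb" "chain se Et" "chain se Eb"
    using G E by (auto intro: chain_subset simp: Gt_def Gb_def Et_def Eb_def)
  with cross have ch: "chain se (Gt \<union> Eb)" "chain se (Et \<union> Gb)"
    unfolding chain_def by blast+
  have dis: "Gt \<inter> Gb = {}" "Et \<inter> Eb = {}" "Gt \<inter> Eb = {}" "Et \<inter> Gb = {}"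
    by (auto simp: Gt_def Gb_def Et_def Eb_def)
  have un: "G = Gt \<union> Gb" "E = Et \<union> Eb" by (auto simp: Gt_def Gb_def Et_def Eb_def)
  have fins: "finite Gt" "finite Gb" "finite Et" "finite Eb"
    using G E by (auto simp: Gt_def Gb_def Et_def Eb_def)
  have "card G = card Gt + card Gb" "card E = card Et + card Eb"
    using un dis fins card_Un_disjoint by metis+
  moreover have "card (Gt \<union> Eb) = card Gt + card Eb" "card (Et \<union> Gb) = card Et + card Gb"
    using dis fins by (auto intro: card_Un_disjoint)
  \<comment> \<open>Each recombined chain misses one of the new points and so has at most
    \<open>?p\<close> points, but \<open>G\<close> and \<open>E\<close> have
    \<open>2 * ?p + 1\<close> together.\<close>
  moreover have "card (Gt \<union> Eb) \<le> ?p"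
  proof -
    have "snd e \<noteq> d" "d < snd e \<or> snd e < d" using in_R(4)[of "fst e" "snd e"] eR by auto
    moreover have "se e (i, d)" using G(2) eG x eR notin bd[OF eR] unfolding chain_def se_def by fastforce
    ultimately have "(i, d) \<notin> Gt" by (auto simp: Gt_def se_def)
    then have "Gt \<union> Eb \<subseteq> insert (c, j) R" using G(1) E(1) by (auto simp: Gt_def Eb_def)
    then show ?thesis using card_le_max_chain[OF _ _ ch(1)] fin assms(3) by (metis finite_insert)
  qed
  moreover have "card (Et \<union> Gb) \<le> ?p"
  proof -
    have "(c, j) \<notin> Gb" using bd[OF eR] by (auto simp: Gb_def)
    then have "Et \<union> Gb \<subseteq> insert (i, d) R" using G(1) E(1) by (auto simp: Gb_def Et_def)
    then show ?thesis using card_le_max_chain[OF _ _ ch(2)] fin assms(2) by (metis finite_insert)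
  qed
  ultimately show False using G E by linarith
qed

end

section \<open>Local rules\<close>

text \<open>\<open>retract l m n\<close> inverts the local rule of a growth diagram at the cell \<open>(i, j)\<close>: from the label
  \<open>l\<close> of its upper right vertex and the labels \<open>m\<close> and \<open>n\<close> of its lower right and upper left vertices,
  it recovers whether the cell is occupied and the label of its lower left vertex.\<close>

locale growth_rule =
  fixes r q :: "nat \<times> nat \<Rightarrow> nat \<times> nat \<Rightarrow> bool"
    and retract :: "nat \<times> nat \<Rightarrow> nat \<times> nat \<Rightarrow> nat \<times> nat \<Rightarrow> bool \<times> (nat \<times> nat)"
  assumes retract_admissible: "\<lbrakk>admissible l; admissible m; admissible n; grow m l; grow n l; retract l
    m n = (b, k)\<rbrakk>
      \<Longrightarrow> admissible k \<and> grow k m \<and> grow k n \<and> (b \<longrightarrow> m = k \<and> n = k)"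
    and label_admissible: "\<lbrakk>finite S; placement S; no_chain3 r S\<rbrakk> \<Longrightarrow> admissible (label q S)"
    and retract_label: "\<lbrakk>placement S; S \<subseteq> box (Suc i) (Suc j); no_chain3 r S\<rbrakk> \<Longrightarrow>
      retract (label q S) (label q (S \<inter> box (Suc i) j)) (label q (S \<inter> box i (Suc j))) =
        ((i, j) \<in> S, label q (S \<inter> box i j))"
    and label_retract: "\<lbrakk>placement S; S \<subseteq> box (Suc i) (Suc j);
        no_chain3 r (S \<inter> box (Suc i) j); no_chain3 r (S \<inter> box i (Suc j)); admissible l;
        grow (label q (S \<inter> box (Suc i) j)) l; grow (label q (S \<inter> box i (Suc j))) l;
        retract l (label q (S \<inter> box (Suc i) j)) (label q (S \<inter> box i (Suc j))) =
          ((i, j) \<in> S, label q (S \<inter> box i j))\<rbrakk> \<Longrightarrow> no_chain3 r S \<and> label q S = l"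

text \<open>Fomin's rule for shapes with two rows (\<open>retract_ne\<close>) and with two columns (\<open>retract_se\<close>). The second
  component of a label is the length of the longer row, respectively column. No subtraction
  is truncated on the admissible labels that can occur around a cell.\<close>

definition retract_ne :: "nat \<times> nat \<Rightarrow> nat \<times> nat \<Rightarrow> nat \<times> nat \<Rightarrow> bool \<times> (nat \<times> nat)"
  where "retract_ne l m n =
    (if m = l then (False, n) else if n = l then (False, m)
     else if snd m \<noteq> snd l \<and> snd n \<noteq> snd l then (True, m)
     else (False, (fst l - 2, snd l - 1)))"

definition retract_se :: "nat \<times> nat \<Rightarrow> nat \<times> nat \<Rightarrow> nat \<times> nat \<Rightarrow> bool \<times> (nat \<times> nat)"
  where "retract_se l m n =
    (if m = l then (False, n) else if n = l then (False, m)
     else if m \<noteq> n then (False, (fst l - 2, snd l - 1))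
     else if snd m = snd l then
       (if fst l = Suc (snd l) then (True, m) else (False, (fst l - 2, snd l)))
     else if fst l = 1 then (True, m)
     else if Suc (fst l) = 2 * snd l then (False, (fst l - 2, snd l - 1))
     else (False, (fst l - 2, snd l - 2)))"

text \<open>The branches after \<open>m = l\<close> either mark the cell or return a label with
  fewer points than \<open>n\<close>. This recovers \<open>l\<close> when the top row is
  empty.\<close>

lemma retract_ne_row:
  "\<lbrakk>admissible l; admissible m; admissible n; grow m l; grow n l; retract_ne l m n = (False, n)\<rbrakk> \<Longrightarrow> m = l"
  by (cases l; cases m; cases n) (auto simp: retract_ne_def admissible_def grow_def split: if_splits)

text \<open>\<open>m \<noteq> n\<close> excludes the first branch, and those after the second mark
  the cell or return fewer points than \<open>m\<close>.\<close>

lemma retract_ne_column: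
  "\<lbrakk>admissible l; admissible m; admissible n; grow m l; grow n l; retract_ne l m n = (False, m); m \<noteq> n\<rbrakk> \<Longrightarrow>
    n = l"
  by (cases l; cases m; cases n) (auto simp: retract_ne_def admissible_def grow_def split: if_splits)

lemma retract_se_row:
  "\<lbrakk>admissible l; admissible m; admissible n; grow m l; grow n l; retract_se l m n = (False, n)\<rbrakk> \<Longrightarrow> m = l"
  by (cases l; cases m; cases n) (auto simp: retract_se_def admissible_def grow_def split: if_splits)

lemma retract_se_column:
  "\<lbrakk>admissible l; admissible m; admissible n; grow m l; grow n l; retract_se l m n = (False, m); m \<noteq> n\<rbrakk> \<Longrightarrow>
    n = l"
  by (cases l; cases m; cases n) (auto simp: retract_se_def admissible_def grow_def split: if_splits)

text \<open>Only the last branch leaves the cell unmarked and returns fewer points than both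
  neighbours have. Its condition says that \<open>x\<close> or \<open>y\<close> equals
  \<open>u\<close>.\<close>

lemma retract_ne_both:
  assumes "retract_ne (t, u) (Suc k, x) (Suc k, y) = (False, (k, p))" "grow (Suc k, x) (t, u)"
    "grow (Suc k, y) (t, u)"
    "admissible (t, u)" "p \<le> x" "p \<le> y"
  shows "t = Suc (Suc k) \<and> u = Suc p \<and> u = max x y \<and> (p < x \<or> p < y)"
  using assms by (auto simp: retract_ne_def grow_def admissible_def max_def split: if_splits)

text \<open>Here \<open>v\<close> is the true length of a longest chain and \<open>u\<close> the one
  claimed by \<open>l\<close>. The last two hypotheses come from \<open>se_both_grow\<close> and
  \<open>se_both_bound\<close>. The delicate case is \<open>x = y = p\<close>, where the growth
  bounds allow both \<open>v = p\<close> and \<open>v = Suc p\<close>, and the number of points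
  decides.\<close>

lemma retract_se_both:
  assumes "retract_se (t, u) (Suc k, x) (Suc k, y) = (False, (k, p))" "grow (Suc k, x) (t, u)"
    "grow (Suc k, y) (t, u)"
    "admissible (t, u)" "p \<le> x" "p \<le> y" "admissible (Suc (Suc k), v)"
    "v \<le> Suc x" "v \<le> Suc y" "x \<le> v" "y \<le> v" "p < x \<and> p < y \<longrightarrow> v = Suc (Suc p)"
    "v = Suc p \<and> x = p \<and> y = p \<longrightarrow> 2 * p \<le> Suc k"
  shows "t = Suc (Suc k) \<and> u = v"
proof -
  have ne: "(Suc k, x) \<noteq> (t, u)" "(Suc k, y) \<noteq> (t, u)"
    using assms(1) by (auto simp: retract_se_def split: if_splits)
  then have t: "t = Suc (Suc k)" and u: "u = x \<or> u = Suc x" "u = y \<or> u = Suc y"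
    using assms(2,3) by (auto simp: grow_def)
  have "u = v"
  proof (cases "x = y")
    case False
    then have "p = u - 1" using assms(1) t by (simp add: retract_se_def)
    then show ?thesis using False u assms(5,6,8-11) by linarith
  next
    case xy: True
    show ?thesis
    proof (cases "u = x")
      case True
      then have "p = u" using assms(1) t xy by (simp add: retract_se_def split: if_splits)
      \<comment> \<open>If \<open>v\<close> were \<open>Suc p\<close>, the last hypothesis would
        give \<open>2 * p \<le> Suc k\<close>, against \<open>Suc (Suc k) \<le> 2 * p\<close> from
        the admissibility of \<open>(t, u)\<close>.\<close>
      then show ?thesis using True xy t assms(4,5-13) by (simp add: admissible_def)
    next
      case False
      then have u: "u = Suc x" using u by simp
      then have *: "p = (if Suc t = 2 * u then u - 1 else u - 2)"
        using assms(1) t xy by (simp add: retract_se_def split: if_splits)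
      have "t \<le> 2 * v" "t \<le> 2 * u" using assms(4,7) t by (simp_all add: admissible_def)
      show ?thesis
      proof (cases "p < x")
        case True
        then show ?thesis using u * assms(12) xy by (simp split: if_splits)
      next
        case False
        then have "p = x" using assms(5) by simp
        then have "Suc t = 2 * u \<or> x = 0" using u * by (auto split: if_splits)
        \<comment> \<open>With \<open>v = x\<close>, admissibility would allow at most
          \<open>2 * x\<close> points, fewer than \<open>t\<close>.\<close>
        then have "v \<noteq> x" using \<open>t \<le> 2 * v\<close> t u by linarith
        then show ?thesis using assms(8,10) u by linarith
      qed
    qed
  qed
  with t show ?thesis by simp
qed

text \<open>If \<open>x = y = p\<close> and \<open>v = Suc p\<close>, then
  \<open>2 * p = Suc k\<close> exactly: one bound is \<open>one\<close>, the other the admissibility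
  of \<open>(Suc k, x)\<close>. The rule tests this equality in the form
  \<open>Suc (fst l) = 2 * snd l\<close>.\<close>

lemma retract_se_both_eq:
  assumes adm: "admissible (Suc k, x)" "admissible (Suc (Suc k), v)"
    and "admissible (k, p)" "p \<le> x" "p \<le> y" "x \<le> Suc p" "y \<le> Suc p"
      "v \<le> Suc x" "v \<le> Suc y" "x \<le> v" "y \<le> v"
    and two: "p < x \<and> p < y \<longrightarrow> v = Suc (Suc p)"
    and one: "v = Suc p \<and> x = p \<and> y = p \<longrightarrow> 2 * p \<le> Suc k"
  shows "retract_se (Suc (Suc k), v) (Suc k, x) (Suc k, y) = (False, (k, p))"
proof (cases "x = y")
  case False
  then have "v = Suc p" using assms(4-11) by linarith
  with False show ?thesis by (simp add: retract_se_def)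
next
  case True
  then consider "x = p" "v = p" | "x = p" "v = Suc p" | "x = Suc p" "v = Suc (Suc p)"
    using assms(4-11) two by linarith
  then show ?thesis
  proof cases
    case 1
    then show ?thesis using True assms(3) by (simp add: retract_se_def admissible_def)
  next
    case 2
    then have "2 * p = Suc k" using one adm True by (simp add: admissible_def)
    then show ?thesis using 2 True by (simp add: retract_se_def)
  next
    case 3
    then have "2 * Suc (Suc p) \<noteq> Suc (Suc (Suc k))" using assms(3) adm by (simp add: admissible_def)
    then show ?thesis using 3 True by (simp add: retract_se_def)
  qed
qed

section \<open>A point in the corner cell\<close>

lemma max_chain_ne_corner:
  assumes "R \<subseteq> box i j"
  shows "max_chain ne (insert (i, j) R) = Suc (max_chain ne R)"
proof -
  have fin: "finite R" using assms finite_subset finite_box by metis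
  then obtain C where C: "C \<subseteq> R" "chain ne C" "card C = max_chain ne R" "finite C"
    by (rule max_chain_attained)
  have "fst p < i \<and> snd p < j" if "p \<in> C" for p using C(1) assms that by (cases p) auto
  then have "chain ne (insert (i, j) C)" using C(2) by (auto simp: chain_def ne_def)
  moreover have "(i, j) \<notin> R" using assms by auto
  ultimately show ?thesis
    using max_chain_less_insertI[OF fin C(1)] C max_chain_insert_le[OF fin, of ne "(i, j)"]
    by (metis le_SucE nat_less_le not_less subset_iff)
qed

lemma no_chain3_se_corner:
  assumes "R \<subseteq> box i j" "no_chain3 se R"
  shows "no_chain3 se (insert (i, j) R)"
proof -
  have "\<not> se (i, j) p \<and> \<not> se p (i, j)" if "p \<in> insert (i, j) R" for p
    using that assms(1) by (cases p) (auto simp: se_def)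
  then show ?thesis using assms(2) unfolding no_chain3_def by blast
qed

text \<open>The corner is \<open>se\<close>-incomparable to all of \<open>R\<close>, so its only new
  nonempty chain is itself. This counts when \<open>R\<close> is empty.\<close>

lemma max_chain_se_corner:
  assumes "R \<subseteq> box i j"
  shows "max_chain se (insert (i, j) R) = max 1 (max_chain se R)"
proof (rule antisym)
  have fin: "finite R" using assms finite_subset finite_box by metis
  then have fin': "finite (insert (i, j) R)" by simp
  then obtain C where C: "C \<subseteq> insert (i, j) R" "chain se C" "card C = max_chain se (insert (i, j) R)"
      "finite C"
    by (rule max_chain_attained)
  have no: "\<not> se (i, j) p \<and> \<not> se p (i, j)" if "p \<in> insert (i, j) R" for p
    using that assms(1) by (cases p) (auto simp: se_def)
  show "max_chain se (insert (i, j) R) \<le> max 1 (max_chain se R)"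
  proof (cases "(i, j) \<in> C")
    case True
    then have "C = {(i, j)}" using C(1,2) no unfolding chain_def by blast
    then show ?thesis using C(3) by simp
  next
    case False
    then have "card C \<le> max_chain se R" using C fin by (intro card_le_max_chain) auto
    then show ?thesis using C(3) by simp
  qed
  have "card {(i, j)} \<le> max_chain se (insert (i, j) R)"
    by (rule card_le_max_chain[OF fin']) (auto simp: chain_def)
  moreover have "max_chain se R \<le> max_chain se (insert (i, j) R)"
    by (rule max_chain_mono[OF fin']) auto
  ultimately show "max 1 (max_chain se R) \<le> max_chain se (insert (i, j) R)" by simp
qed

text \<open>As \<open>(i, j)\<close> is north-east of all of \<open>R\<close>, avoidance means that
  \<open>R\<close> has no increasing pair, so that \<open>R\<close> itself is a decreasing
  chain.\<close>

lemma no_chain3_ne_corner: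
  assumes "R \<subseteq> box i j" "placement R"
  shows "no_chain3 ne (insert (i, j) R) \<longleftrightarrow> max_chain se R = card R"
proof
  have fin: "finite R" using assms finite_subset finite_box by metis
  have top: "ne p (i, j)" if "p \<in> R" for p using that assms(1) by (cases p) (auto simp: ne_def)
  {
    assume no: "no_chain3 ne (insert (i, j) R)"
    have "\<not> ne p q" if "p \<in> R" "q \<in> R" for p q
      using no top[OF that(2)] that unfolding no_chain3_def by blast
    then have "chain se R" using placement_cases[OF assms(2)] unfolding chain_def by metis
    then show "max_chain se R = card R"
      using card_le_max_chain[OF fin subset_refl] max_chain_le_card[OF fin, of se] by (metis antisym)
  }
  {
    assume eq: "max_chain se R = card R"
    obtain C where C: "C \<subseteq> R" "chain se C" "card C = max_chain se R" "finite C"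
      using fin by (rule max_chain_attained)
    then have "chain se R" using eq fin by (metis card_subset_eq)
    then have no: "\<not> ne p q" if "p \<in> R" "q \<in> R" for p q
      using that unfolding chain_def by (cases "p = q") (fastforce simp: ne_def se_def)+
    have "\<not> ne (i, j) p" if "p \<in> insert (i, j) R" for p
      using that assms(1) by (cases p) (auto simp: ne_def)
    then show "no_chain3 ne (insert (i, j) R)"
      using no unfolding no_chain3_def by blast
  }
qed

text \<open>An occupied corner leaves both neighbouring lengths below the new one. With points in
  both the last row and column, \<open>max_chain_ne_both\<close> makes one of them equal to it, and
  \<open>ne_grows\<close> puts the inner length one lower. \<open>retract_ne\<close> tests this
  difference.\<close>

lemma growth_rule_ne: "growth_rule se ne retract_ne"
proof
  fix l m n k :: "nat \<times> nat" and b
  assume "admissible l" "admissible m" "admissible n" "grow m l" "grow n l" "retract_ne l m n = (b, k)"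
  then show "admissible k \<and> grow k m \<and> grow k n \<and> (b \<longrightarrow> m = k \<and> n = k)"
    by (cases l; cases m; cases n) (auto simp: retract_ne_def admissible_def grow_def split: if_splits)
next
  fix S :: "(nat \<times> nat) set"
  assume "finite S" "placement S" "no_chain3 se S"
  then show "admissible (label ne S)"
    by (intro admissible_label[of _ se]) (use placement_cases in metis)+
next
  fix S i j
  assume S: "placement S" "S \<subseteq> box (Suc i) (Suc j)" and av: "no_chain3 se S"
  define R where "R = S \<inter> box i j"
  have R: "R \<subseteq> box i j" by (simp add: R_def)
  have fin: "finite R" using R finite_subset finite_box by metis
  show "retract_ne (label ne S) (label ne (S \<inter> box (Suc i) j)) (label ne (S \<inter> box i (Suc j))) =
        ((i, j) \<in> S, label ne (S \<inter> box i j))"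
  proof (cases rule: corner_cases[OF S, where r = ne, folded R_def, case_names full row_empty col_empty
    both])
    case full
    have "(i, j) \<notin> R" using R by auto
    then have lS: "label ne S = (Suc (card R), Suc (max_chain ne R))"
      using full(4) max_chain_ne_corner[OF R] fin by (metis label_def card_insert_disjoint)
    have lR: "label ne R = (card R, max_chain ne R)" by (simp add: label_def)
    show ?thesis using full(1) unfolding R_def[symmetric] full(2,3) by (simp add: retract_ne_def lR lS)
  next
    case row_empty
    show ?thesis using row_empty(1) unfolding R_def[symmetric] row_empty(2,3) by (simp add: retract_ne_def)
  next
    case col_empty
    show ?thesis using col_empty(1,4) unfolding R_def[symmetric] col_empty(2,3)
      by (simp add: retract_ne_def)
  next
    case (both c d)
    interpret two_points R i j c d
      using both S(1) R by unfold_locales simp_all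
    let ?x = "max_chain ne (insert (i, d) R)" and ?y = "max_chain ne (insert (c, j) R)"
    have "max_chain ne R < ?x \<or> max_chain ne R < ?y"
      using ne_grows av both by metis
    moreover have "?x \<le> Suc (max_chain ne R)" "?y \<le> Suc (max_chain ne R)" "max_chain ne R \<le> ?x"
      "max_chain ne R \<le> ?y"
      using fin by (auto intro: max_chain_insert_le max_chain_mono)
    moreover have "label ne S = (Suc (Suc (card R)), max ?x ?y)"
      using notin cd fin max_chain_ne_both by (simp add: label_def both(8))
    moreover have "label ne (insert (i, d) R) = (Suc (card R), ?x)"
      "label ne (insert (c, j) R) = (Suc (card R), ?y)"
      "label ne R = (card R, max_chain ne R)"
      using notin fin by (simp_all add: label_def)
    ultimately show ?thesis
      using both(1) unfolding R_def[symmetric] both(6,7)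
      by (auto simp: retract_ne_def max_def)
  qed
next
  fix S i j l
  assume S: "placement S" "S \<subseteq> box (Suc i) (Suc j)"
    and av: "no_chain3 se (S \<inter> box (Suc i) j)" "no_chain3 se (S \<inter> box i (Suc j))"
    and adm: "admissible l"
    and gr: "grow (label ne (S \<inter> box (Suc i) j)) l" "grow (label ne (S \<inter> box i (Suc j))) l"
    and retract: "retract_ne l (label ne (S \<inter> box (Suc i) j)) (label ne (S \<inter> box i (Suc j))) =
          ((i, j) \<in> S, label ne (S \<inter> box i j))"
  define R where "R = S \<inter> box i j"
  have R: "R \<subseteq> box i j" by (simp add: R_def)
  have fin: "finite R" using R finite_subset finite_box by metis
  have adm': "admissible (label ne (S \<inter> box (Suc i) j))" "admissible (label ne (S \<inter> box i (Suc j)))"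
    using av placement_cases[OF S(1)] by (auto intro!: admissible_label[of _ se])
  show "no_chain3 se S \<and> label ne S = l"
  proof (cases rule: corner_cases[OF S, where r = ne, folded R_def, case_names full row_empty col_empty
    both])
    case full
    have "(i, j) \<notin> R" using R by auto
    then have lS: "label ne S = (Suc (card R), Suc (max_chain ne R))"
      using full(4) max_chain_ne_corner[OF R] fin by (metis label_def card_insert_disjoint)
    have lR: "label ne R = (card R, max_chain ne R)" by (simp add: label_def)
    have "no_chain3 se R" using av(1) full(2) by simp
    then have "no_chain3 se S"
      using full(4) no_chain3_se_corner[OF R] by metis
    moreover have "l = (Suc (card R), Suc (max_chain ne R))"
      using retract gr(1) full(1) unfolding R_def[symmetric] full(2,3) lR
      by (cases l) (auto simp: retract_ne_def grow_def split: if_splits)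
    ultimately show ?thesis by (simp add: lS)
  next
    case row_empty
    have "label ne S = l"
      using retract_ne_row[OF adm adm' gr] retract row_empty(1)
        unfolding R_def[symmetric] row_empty(2,3) by simp
    then show ?thesis using av row_empty(3) by simp
  next
    case col_empty
    have "label ne S = l"
      using retract_ne_column[OF adm adm' gr] retract col_empty(1,4)
        unfolding R_def[symmetric] col_empty(2,3) by simp
    then show ?thesis using av col_empty(3) by simp
  next
    case (both c d)
    interpret two_points R i j c d
      using both S(1) R by unfold_locales simp_all
    let ?x = "max_chain ne (insert (i, d) R)" and ?y = "max_chain ne (insert (c, j) R)"
    obtain t u where l: "l = (t, u)" by fastforce
    have cards: "card (insert (i, d) R) = Suc (card R)" "card (insert (c, j) R) = Suc (card R)"
      "card S = Suc (Suc (card R))"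
      using notin cd fin by (simp_all add: both(8))
    have retract': "retract_ne l (Suc (card R), ?x) (Suc (card R), ?y) = (False, (card R, max_chain ne R))"
      using retract both(1) cards unfolding R_def[symmetric] both(6,7) by (simp add: label_def)
    have gr': "grow (Suc (card R), ?x) l" "grow (Suc (card R), ?y) l"
      using gr cards unfolding R_def[symmetric] both(6,7) by (simp_all add: label_def)
    have b: "max_chain ne R \<le> ?x" "max_chain ne R \<le> ?y"
      using fin by (auto intro: max_chain_mono)
    note u = retract_ne_both[OF retract'[unfolded l] gr'[unfolded l] adm[unfolded l] b]
    have "no_chain3 se S"
      using no_chain3_se_both av u unfolding R_def[symmetric] both(6,7) both(8)[symmetric] by simp
    moreover have "max_chain ne S = max ?x ?y"
      using max_chain_ne_both both(8) by simp
    ultimately show ?thesis using u cards by (simp add: l label_def)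
  qed
qed

text \<open>Below an occupied corner \<open>R\<close> is a decreasing chain, with label
  \<open>(k, k)\<close>, and \<open>retract_se\<close> recognizes this shape. Points in both the
  last row and column are treated by \<open>retract_se_both_eq\<close> and
  \<open>retract_se_both\<close>.\<close>

lemma growth_rule_se: "growth_rule ne se retract_se"
proof
  fix l m n k :: "nat \<times> nat" and b
  assume "admissible l" "admissible m" "admissible n" "grow m l" "grow n l" "retract_se l m n = (b, k)"
  then show "admissible k \<and> grow k m \<and> grow k n \<and> (b \<longrightarrow> m = k \<and> n = k)"
    by (cases l; cases m; cases n) (auto simp: retract_se_def admissible_def grow_def split: if_splits)
next
  fix S :: "(nat \<times> nat) set"
  assume "finite S" "placement S" "no_chain3 ne S"
  then show "admissible (label se S)"
    by (intro admissible_label[of _ ne]) (use placement_cases in metis)+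
next
  fix S i j
  assume S: "placement S" "S \<subseteq> box (Suc i) (Suc j)" and av: "no_chain3 ne S"
  define R where "R = S \<inter> box i j"
  have R: "R \<subseteq> box i j" by (simp add: R_def)
  have fin: "finite R" using R finite_subset finite_box by metis
  have plR: "placement R" using placement_subset[OF S(1)] by (simp add: R_def)
  show "retract_se (label se S) (label se (S \<inter> box (Suc i) j)) (label se (S \<inter> box i (Suc j))) =
        ((i, j) \<in> S, label se (S \<inter> box i j))"
  proof (cases rule: corner_cases[OF S, where r = se, folded R_def, case_names full row_empty col_empty
    both])
    case full
    have "(i, j) \<notin> R" using R by auto
    then have lS: "label se S = (Suc (card R), max 1 (max_chain se R))"
      using full(4) max_chain_se_corner[OF R] fin by (metis label_def card_insert_disjoint)
    have lR: "label se R = (card R, card R)" and eq: "max_chain se R = card R"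
      using no_chain3_ne_corner[OF R plR] av full(4) by (simp_all add: label_def)
    show ?thesis using full(1) unfolding R_def[symmetric] full(2,3)
      by (simp add: retract_se_def lR lS eq max_def)
  next
    case row_empty
    show ?thesis using row_empty(1) unfolding R_def[symmetric] row_empty(2,3) by (simp add: retract_se_def)
  next
    case col_empty
    show ?thesis using col_empty(1,4) unfolding R_def[symmetric] col_empty(2,3)
      by (simp add: retract_se_def)
  next
    case (both c d)
    interpret two_points R i j c d
      using both S(1) R by unfold_locales simp_all
    let ?x = "max_chain se (insert (i, d) R)" and ?y = "max_chain se (insert (c, j) R)"
    let ?p = "max_chain se R"
    have b: "?x \<le> Suc ?p" "?y \<le> Suc ?p" "?p \<le> ?x" "?p \<le> ?y"
      using fin by (auto intro: max_chain_insert_le max_chain_mono)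
    have b2: "max_chain se S \<le> Suc ?x" "max_chain se S \<le> Suc ?y" "?x \<le> max_chain se S" "?y \<le> max_chain se S"
      using max_chain_insert_le[of "insert (i, d) R" se "(c, j)"] max_chain_insert_le[of
        "insert (c, j) R" se "(i, d)"] fin
      by (auto simp: both(8) insert_commute intro: max_chain_mono)
    have two: "?p < ?x \<and> ?p < ?y \<longrightarrow> max_chain se S = Suc (Suc ?p)"
      using se_both_grow both(8) by simp
    have one: "max_chain se S = Suc ?p \<and> ?x = ?p \<and> ?y = ?p \<longrightarrow> 2 * ?p \<le> Suc (card R)"
      using se_both_bound both(8) by simp
    have labs: "label se S = (Suc (Suc (card R)), max_chain se S)"
      "label se (insert (i, d) R) = (Suc (card R), ?x)" "label se (insert (c, j) R) = (Suc (card R), ?y)"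
      "label se R = (card R, ?p)"
      using notin cd fin by (simp_all add: label_def both(8))
    have "no_chain3 ne (insert (i, d) R)" "no_chain3 ne R"
      using both(8) by (auto intro!: no_chain3_subset[OF av])
    then have "admissible (label se S)" "admissible (label se (insert (i, d) R))" "admissible (label se R)"
      using av fin placement_cases[OF S(1)] both(8)
      by (auto intro!: admissible_label[of _ ne])
    from retract_se_both_eq[OF this(2,1,3)[unfolded labs] b(3,4,1,2) b2 two one]
    show ?thesis using both(1) unfolding R_def[symmetric] both(6,7) labs by simp
  qed
next
  fix S i j l
  assume S: "placement S" "S \<subseteq> box (Suc i) (Suc j)"
    and av: "no_chain3 ne (S \<inter> box (Suc i) j)" "no_chain3 ne (S \<inter> box i (Suc j))"
    and adm: "admissible l"
    and gr: "grow (label se (S \<inter> box (Suc i) j)) l" "grow (label se (S \<inter> box i (Suc j))) l"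
    and retract: "retract_se l (label se (S \<inter> box (Suc i) j)) (label se (S \<inter> box i (Suc j))) =
          ((i, j) \<in> S, label se (S \<inter> box i j))"
  define R where "R = S \<inter> box i j"
  have R: "R \<subseteq> box i j" by (simp add: R_def)
  have fin: "finite R" using R finite_subset finite_box by metis
  have plR: "placement R" using placement_subset[OF S(1)] by (simp add: R_def)
  have adm': "admissible (label se (S \<inter> box (Suc i) j))" "admissible (label se (S \<inter> box i (Suc j)))"
    using av placement_cases[OF S(1)] by (auto intro!: admissible_label[of _ ne])
  show "no_chain3 ne S \<and> label se S = l"
  proof (cases rule: corner_cases[OF S, where r = se, folded R_def, case_names full row_empty col_empty
    both])
    case full
    have "(i, j) \<notin> R" using R by auto
    then have lS: "label se S = (Suc (card R), max 1 (max_chain se R))"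
      using full(4) max_chain_se_corner[OF R] fin by (metis label_def card_insert_disjoint)
    have lR: "label se R = (card R, max_chain se R)" by (simp add: label_def)
    \<comment> \<open>Two branches mark the cell. With \<open>snd m = snd l\<close> and
      \<open>fst l = Suc (snd l)\<close>, the longest chain of \<open>R\<close> has all its points;
      with \<open>fst l = 1\<close>, \<open>R\<close> is empty.\<close>
    have eq: "max_chain se R = card R" "l = (Suc (card R), max 1 (card R))"
      using retract gr(1) adm max_chain_le_card[OF fin, of se] full(1)
        unfolding R_def[symmetric] full(2,3) lR
      by (cases l; auto simp: retract_se_def grow_def admissible_def split: if_splits)+
    then have "no_chain3 ne S"
      using full(4) no_chain3_ne_corner[OF R plR] by metis
    then show ?thesis by (simp add: lS eq)
  next
    case row_empty
    have "label se S = l"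
      using retract_se_row[OF adm adm' gr] retract row_empty(1)
        unfolding R_def[symmetric] row_empty(2,3) by simp
    then show ?thesis using av row_empty(3) by simp
  next
    case col_empty
    have "label se S = l"
      using retract_se_column[OF adm adm' gr] retract col_empty(1,4)
        unfolding R_def[symmetric] col_empty(2,3) by simp
    then show ?thesis using av col_empty(3) by simp
  next
    case (both c d)
    interpret two_points R i j c d
      using both S(1) R by unfold_locales simp_all
    let ?x = "max_chain se (insert (i, d) R)" and ?y = "max_chain se (insert (c, j) R)"
    let ?p = "max_chain se R"
    obtain t u where l: "l = (t, u)" by fastforce
    have cards: "card (insert (i, d) R) = Suc (card R)" "card (insert (c, j) R) = Suc (card R)"
      "card S = Suc (Suc (card R))"
      using notin cd fin by (simp_all add: both(8))
    have retract': "retract_se l (Suc (card R), ?x) (Suc (card R), ?y) = (False, (card R, ?p))"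
      using retract both(1) cards unfolding R_def[symmetric] both(6,7) by (simp add: label_def)
    have gr': "grow (Suc (card R), ?x) l" "grow (Suc (card R), ?y) l"
      using gr cards unfolding R_def[symmetric] both(6,7) by (simp_all add: label_def)
    have b: "?x \<le> Suc ?p" "?y \<le> Suc ?p" "?p \<le> ?x" "?p \<le> ?y"
      using fin by (auto intro: max_chain_insert_le max_chain_mono)
    have b2: "max_chain se S \<le> Suc ?x" "max_chain se S \<le> Suc ?y" "?x \<le> max_chain se S" "?y \<le> max_chain se S"
      using max_chain_insert_le[of "insert (i, d) R" se "(c, j)"] max_chain_insert_le[of
        "insert (c, j) R" se "(i, d)"] fin
      by (auto simp: both(8) insert_commute intro: max_chain_mono)
    have two: "?p < ?x \<and> ?p < ?y \<longrightarrow> max_chain se S = Suc (Suc ?p)"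
      using se_both_grow both(8) by simp
    have one: "max_chain se S = Suc ?p \<and> ?x = ?p \<and> ?y = ?p \<longrightarrow> 2 * ?p \<le> Suc (card R)"
      using se_both_bound both(8) by simp
    have av': "no_chain3 ne S"
      using no_chain3_ne_both av unfolding R_def[symmetric] both(6,7) both(8)[symmetric] by simp
    have "admissible (card S, max_chain se S)"
      unfolding label_def[symmetric] using fin av' placement_cases[OF S(1)]
      by (intro admissible_label[of _ ne]) (auto simp: both(8))
    then have "admissible (Suc (Suc (card R)), max_chain se S)" using cards by simp
    from retract_se_both[OF retract'[unfolded l] gr'[unfolded l] adm[unfolded l] b(3,4) this b2 two one]
    have "t = Suc (Suc (card R)) \<and> u = max_chain se S" .
    with av' show ?thesis using cards by (simp add: l label_def)
  qed
qed

section \<open>Fillings of Ferrers boards\<close>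

definition down_closed :: "(nat \<times> nat) set \<Rightarrow> bool"
  where "down_closed F \<longleftrightarrow> (\<forall>a b a' b'. (a, b) \<in> F \<longrightarrow> a' \<le> a \<longrightarrow> b' \<le> b \<longrightarrow> (a', b') \<in> F)"

text \<open>\<open>border F a b\<close>: the vertex \<open>(a, b)\<close> lies on the boundary path of \<open>F\<close>, prolonged along the axes.\<close>

definition border :: "(nat \<times> nat) set \<Rightarrow> nat \<Rightarrow> nat \<Rightarrow> bool"
  where "border F a b \<longleftrightarrow> box a b \<subseteq> F \<and> (a, b) \<notin> F"

definition board_avoids :: "(nat \<times> nat \<Rightarrow> nat \<times> nat \<Rightarrow> bool) \<Rightarrow> (nat \<times> nat) set \<Rightarrow> (nat \<times> nat) set \<Rightarrow> bool"
  where "board_avoids r F T \<longleftrightarrow> (\<forall>a b. box a b \<subseteq> F \<longrightarrow> no_chain3 r (T \<inter> box a b))"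

text \<open>Neither relation occurs here, so the same label families serve both kinds of fillings.
  The value \<open>(0, 0)\<close> on the axes is the label of an empty rectangle.\<close>

definition border_labels :: "(nat \<times> nat) set \<Rightarrow> (nat \<Rightarrow> nat \<Rightarrow> nat \<times> nat) \<Rightarrow> bool"
  where "border_labels F s \<longleftrightarrow>
    (\<forall>a b. border F a b \<longrightarrow> admissible (s a b) \<and> (a = 0 \<or> b = 0 \<longrightarrow> s a b = (0, 0)) \<and>
      (border F (Suc a) b \<longrightarrow> grow (s a b) (s (Suc a) b)) \<and>
      (border F a (Suc b) \<longrightarrow> grow (s a b) (s a (Suc b))))"

definition filling :: "(nat \<times> nat \<Rightarrow> nat \<times> nat \<Rightarrow> bool) \<Rightarrow> (nat \<times> nat \<Rightarrow> nat \<times> nat \<Rightarrow> bool) \<Rightarrow>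
    (nat \<times> nat) set \<Rightarrow> (nat \<Rightarrow> nat \<Rightarrow> nat \<times> nat) \<Rightarrow> (nat \<times> nat) set \<Rightarrow> bool"
  where "filling r q F s T \<longleftrightarrow> T \<subseteq> F \<and> placement T \<and> board_avoids r F T \<and>
    (\<forall>a b. border F a b \<longrightarrow> label q (T \<inter> box a b) = s a b)"

lemma down_closedD: "down_closed F \<Longrightarrow> (a, b) \<in> F \<Longrightarrow> a' \<le> a \<Longrightarrow> b' \<le> b \<Longrightarrow> (a', b') \<in> F"
  unfolding down_closed_def by blast

lemma box_empty [simp]: "box 0 b = {}" "box a 0 = {}"
  by (simp_all add: box_def)

text \<open>Take a cell with the largest coordinate sum.\<close>

lemma down_closed_corner:
  assumes "finite F" "F \<noteq> {}"
  obtains i j where "(i, j) \<in> F" "(Suc i, j) \<notin> F" "(i, Suc j) \<notin> F"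
proof -
  define f where "f = (\<lambda>p::nat \<times> nat. fst p + snd p)"
  have "Max (f ` F) \<in> f ` F" using assms by (intro Max_in) auto
  then obtain i j where ij: "(i, j) \<in> F" "Max (f ` F) = f (i, j)" by auto
  have le: "f p \<le> f (i, j)" if "p \<in> F" for p
    using that assms(1) ij(2)[symmetric] by simp
  have "(Suc i, j) \<notin> F" "(i, Suc j) \<notin> F"
    using le[of "(Suc i, j)"] le[of "(i, Suc j)"] by (auto simp: f_def)
  then show ?thesis using that ij by blast
qed

section \<open>Fillings and their border labels\<close>

lemma (in growth_rule) border_labels_label:
  assumes "placement T" "board_avoids r F T"
  shows "border_labels F (\<lambda>a b. label q (T \<inter> box a b))"
  unfolding border_labels_def
proof (intro allI impI)
  fix a b assume "border F a b"
  then have "no_chain3 r (T \<inter> box a b)" using assms(2) unfolding board_avoids_def border_def by blast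
  then have "admissible (label q (T \<inter> box a b))"
    by (intro label_admissible placement_subset[OF assms(1)]) auto
  moreover have "label q (T \<inter> box a b) = (0, 0)" if "a = 0 \<or> b = 0"
    using that by (auto simp: label_empty)
  ultimately show "admissible (label q (T \<inter> box a b)) \<and> (a = 0 \<or> b = 0 \<longrightarrow> label q (T \<inter> box a b) = (0, 0)) \<and>
      (border F (Suc a) b \<longrightarrow> grow (label q (T \<inter> box a b)) (label q (T \<inter> box (Suc a) b))) \<and>
      (border F a (Suc b) \<longrightarrow> grow (label q (T \<inter> box a b)) (label q (T \<inter> box a (Suc b))))"
    using grow_column[OF assms(1)] grow_row[OF assms(1)] by simp
qed

text \<open>Induction on the number of cells, removing a corner cell \<open>(i, j)\<close>. The
  border then passes through \<open>(i, j)\<close> instead of \<open>(Suc i, Suc j)\<close>, and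
  \<open>retract\<close> supplies the label of the new vertex and the content of the removed
  cell.\<close>

lemma (in growth_rule) unique_filling:
  assumes "finite F" "down_closed F" "border_labels F s"
  shows "\<exists>!T. filling r q F s T"
  using assms
proof (induction F arbitrary: s rule: measure_induct_rule[where f = card])
  case (less F)
  note fin = less.prems(1) and dc = down_closedD[OF less.prems(2)] and lab = less.prems(3)
  show ?case
  proof (cases "F = {}")
    case True
    have "a = 0 \<or> b = 0" if "border {} a b" for a b
      using that by (auto simp: border_def box_def lessThan_empty_iff)
    then have "s a b = (0, 0)" if "border {} a b" for a b
      using lab that unfolding border_labels_def True by blast
    then have "filling r q F s T \<longleftrightarrow> T = {}" for T
      by (auto simp: filling_def board_avoids_def no_chain3_empty label_empty True placement_def)
    then show ?thesis by simp
  next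
    case False
    obtain i j where ij: "(i, j) \<in> F" "(Suc i, j) \<notin> F" "(i, Suc j) \<notin> F"
      using fin False by (rule down_closed_corner)
    define F' where "F' = F - {(i, j)}"
    have inF: "a < i \<or> a = i \<or> b < j" "b < j \<or> b = j \<or> a < i" if "(a, b) \<in> F" for a b
      using dc[OF that, of "Suc i" j] dc[OF that, of i "Suc j"] ij by (force simp: not_less_eq)+
    have boxF: "box (Suc i) (Suc j) \<subseteq> F" using dc[OF ij(1)] by (auto simp: less_Suc_eq_le)
    \<comment> \<open>Only one rectangle of the board contains the corner cell, so only one
      avoidance condition is new.\<close>
    have big: "a = Suc i \<and> b = Suc j" if "box a b \<subseteq> F" "i < a" "j < b" for a b
    proof (rule ccontr)
      assume "\<not> ?thesis"
      then have "(Suc i, j) \<in> box a b \<or> (i, Suc j) \<in> box a b" using that(2,3) by auto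
      then show False using that(1) ij by blast
    qed
    have boxF': "box a b \<subseteq> F' \<longleftrightarrow> box a b \<subseteq> F \<and> \<not> (i < a \<and> j < b)" for a b
      unfolding F'_def using in_box[of i j a b] by blast
    have border': "border F' a b \<longleftrightarrow> border F a b \<and> (a, b) \<noteq> (Suc i, Suc j) \<or> (a, b) = (i, j)" for a b
    proof
      assume "border F' a b"
      then show "border F a b \<and> (a, b) \<noteq> (Suc i, Suc j) \<or> (a, b) = (i, j)"
        unfolding border_def boxF' by (auto simp: F'_def)
    next
      assume "border F a b \<and> (a, b) \<noteq> (Suc i, Suc j) \<or> (a, b) = (i, j)"
      then show "border F' a b"
      proof
        assume "border F a b \<and> (a, b) \<noteq> (Suc i, Suc j)"
        then show ?thesis using big[of a b] unfolding border_def boxF' by (auto simp: F'_def)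
      next
        assume "(a, b) = (i, j)"
        moreover have "box i j \<subseteq> F" using boxF by auto
        ultimately show ?thesis unfolding border_def boxF' by (auto simp: F'_def)
      qed
    qed
    have bor: "border F (Suc i) (Suc j)" "border F (Suc i) j" "border F i (Suc j)"
      using boxF ij dc[of "Suc i" "Suc j" "Suc i" j] unfolding border_def by auto
    obtain b k where retract: "retract (s (Suc i) (Suc j)) (s (Suc i) j) (s i (Suc j)) = (b, k)"
      by (metis surj_pair)
    have adm: "admissible (s (Suc i) (Suc j))" "admissible (s (Suc i) j)" "admissible (s i (Suc j))"
      and gr: "grow (s (Suc i) j) (s (Suc i) (Suc j))" "grow (s i (Suc j)) (s (Suc i) (Suc j))"
      using lab bor unfolding border_labels_def by blast+
    have k: "admissible k" "grow k (s (Suc i) j)" "grow k (s i (Suc j))"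
      "b \<Longrightarrow> s (Suc i) j = k" "b \<Longrightarrow> s i (Suc j) = k"
      using retract_admissible[OF adm gr retract] by auto
    define s' where "s' = (\<lambda>x y. if x = i \<and> y = j then k else s x y)"
    have "border_labels F' s'"
      unfolding border_labels_def
    proof (intro allI impI)
      fix x y assume xy: "border F' x y"
      show "admissible (s' x y) \<and> (x = 0 \<or> y = 0 \<longrightarrow> s' x y = (0, 0)) \<and>
        (border F' (Suc x) y \<longrightarrow> grow (s' x y) (s' (Suc x) y)) \<and>
        (border F' x (Suc y) \<longrightarrow> grow (s' x y) (s' x (Suc y)))"
      proof (cases "x = i \<and> y = j")
        case True
        have "k = (0, 0)" if "i = 0 \<or> j = 0"
        proof -
          have "s (Suc i) j = (0, 0) \<or> s i (Suc j) = (0, 0)"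
            using that lab bor unfolding border_labels_def by blast
          then show ?thesis using k by (cases k) (auto simp: grow_def)
        qed
        then show ?thesis using True k by (simp add: s'_def)
      next
        case False
        then have old: "border F x y" using xy border'[of x y] by blast
        \<comment> \<open>A vertex directly left of or below \<open>(i, j)\<close> indexes a cell of
          \<open>F\<close>, so it is not on the border; the steps from old vertices keep their
          labels.\<close>
        have "\<not> (Suc x = i \<and> y = j)" "\<not> (x = i \<and> Suc y = j)"
          using old dc[OF ij(1), of x y] unfolding border_def by auto
        then have "s' x y = s x y" "s' (Suc x) y = s (Suc x) y" "s' x (Suc y) = s x (Suc y)"
          "border F' (Suc x) y \<Longrightarrow> border F (Suc x) y" "border F' x (Suc y) \<Longrightarrow> border F x (Suc y)"
          using False border'[of "Suc x" y] border'[of x "Suc y"] by (auto simp: s'_def)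
        then show ?thesis using old lab unfolding border_labels_def by simp
      qed
    qed
    moreover have "card F' < card F" "finite F'"
      using fin ij(1) unfolding F'_def by (simp_all only: card_Diff1_less finite_Diff)
    moreover have "down_closed F'"
      unfolding down_closed_def
    proof (intro allI impI)
      fix a b a' b' assume ab: "(a, b) \<in> F'" "a' \<le> a" "b' \<le> b"
      then have "(a, b) \<in> F" "(a, b) \<noteq> (i, j)" by (auto simp: F'_def)
      then have "(a', b') \<in> F" "(a', b') \<noteq> (i, j)"
        using dc[OF _ ab(2,3)] inF[of a b] ab(2,3) by auto
      then show "(a', b') \<in> F'" by (simp add: F'_def)
    qed
    ultimately have ex1: "\<exists>!T. filling r q F' s' T"
      using less.IH by blast
    have inter: "T \<inter> box x y = (T - {(i, j)}) \<inter> box x y" if "box x y \<subseteq> F'" for T x y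
      using that unfolding boxF' by auto
    have sub: "T \<inter> box (Suc i) (Suc j) \<inter> box (Suc i) j = T \<inter> box (Suc i) j"
      "T \<inter> box (Suc i) (Suc j) \<inter> box i (Suc j) = T \<inter> box i (Suc j)"
      "T \<inter> box (Suc i) (Suc j) \<inter> box i j = T \<inter> box i j" for T
      by auto
    have small: "box (Suc i) j \<subseteq> F'" "box i (Suc j) \<subseteq> F'" "box i j \<subseteq> F'"
      using boxF by (auto simp: F'_def)
    \<comment> \<open>This gives uniqueness: a filling of \<open>F\<close> restricts to the only
      filling of \<open>F'\<close>, and \<open>b\<close> prescribes the corner.\<close>
    have down: "filling r q F' s' (T - {(i, j)}) \<and> ((i, j) \<in> T \<longleftrightarrow> b)" if T: "filling r q F s T" for T
    proof -
      let ?S = "T \<inter> box (Suc i) (Suc j)"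
      have "retract (label q ?S) (label q (?S \<inter> box (Suc i) j)) (label q (?S \<inter> box i (Suc j))) =
        ((i, j) \<in> ?S, label q (?S \<inter> box i j))"
        using T boxF unfolding filling_def board_avoids_def
        by (intro retract_label) (auto intro: placement_subset)
      then have "(b, k) = ((i, j) \<in> T, label q (T \<inter> box i j))"
        unfolding sub using T bor retract by (simp add: filling_def)
      then have bk: "b \<longleftrightarrow> (i, j) \<in> T" "label q (T \<inter> box i j) = k" by simp_all
      have "label q ((T - {(i, j)}) \<inter> box x y) = s' x y" if xy: "border F' x y" for x y
      proof -
        have "label q (T \<inter> box x y) = s' x y"
          using xy T bk(2) unfolding border' filling_def by (auto simp: s'_def)
        then show ?thesis using inter[of x y T] xy unfolding border_def by simp
      qed
      moreover have "board_avoids r F' (T - {(i, j)})"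
        using T unfolding filling_def board_avoids_def boxF'
        by (metis Diff_subset Int_mono no_chain3_subset order_refl)
      ultimately show ?thesis
        using T bk(1) by (auto simp: filling_def F'_def intro: placement_subset)
    qed
    obtain T1 where T1: "filling r q F' s' T1" using ex1 by blast
    define T where "T = (if b then insert (i, j) T1 else T1)"
    have T1F: "T1 \<subseteq> F'" and plT1: "placement T1" using T1 by (auto simp: filling_def)
    have TT1: "T - {(i, j)} = T1" using T1F by (auto simp: T_def F'_def)
    have memT: "(i, j) \<in> T \<longleftrightarrow> b" using T1F by (auto simp: T_def F'_def)
    have labT: "label q (T \<inter> box x y) = s' x y" if "border F' x y" for x y
      using T1 that inter[of x y T] unfolding TT1 filling_def border_def by simp
    have avT: "no_chain3 r (T \<inter> box x y)" if "box x y \<subseteq> F'" for x y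
      using T1 that inter[of x y T] unfolding TT1 filling_def board_avoids_def by simp
    have labs: "label q (T \<inter> box (Suc i) j) = s (Suc i) j" "label q (T \<inter> box i (Suc j)) = s i (Suc j)"
      "label q (T \<inter> box i j) = k"
      using labT[of "Suc i" j] labT[of i "Suc j"] labT[of i j] bor by (simp_all add: s'_def border')
    have pl: "placement T"
    proof (cases b)
      case True
      \<comment> \<open>When the corner is marked, both neighbouring labels equal \<open>k\<close>;
        equal cardinalities leave the rest of column \<open>i\<close> and row \<open>j\<close>
        empty.\<close>
      have "card (T \<inter> box (Suc i) j) = card (T \<inter> box i j)" "card (T \<inter> box i (Suc j)) = card (T \<inter> box i j)"
        using labs k(4,5)[OF True] by (auto simp: label_def)
      then have eq: "T \<inter> box i j = T \<inter> box (Suc i) j" "T \<inter> box i j = T \<inter> box i (Suc j)"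
        by (intro card_subset_eq; auto)+
      have "y \<noteq> i" if "(y, x) \<in> T1" for x y
      proof
        assume "y = i"
        then have "(i, x) \<in> F'" using that T1F by blast
        then have "x < j" using inF[of i x] by (auto simp: F'_def)
        then have "(i, x) \<in> T \<inter> box (Suc i) j" using that \<open>y = i\<close> by (auto simp: T_def)
        then show False unfolding eq(1)[symmetric] by simp
      qed
      moreover have "x \<noteq> j" if "(y, x) \<in> T1" for x y
      proof
        assume "x = j"
        then have "(y, j) \<in> F'" using that T1F by blast
        then have "y < i" using inF[of y j] by (auto simp: F'_def)
        then have "(y, j) \<in> T \<inter> box i (Suc j)" using that \<open>x = j\<close> by (auto simp: T_def)
        then show False unfolding eq(2)[symmetric] by simp
      qed
      ultimately have "i \<notin> fst ` T1" "j \<notin> snd ` T1" by force+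
      then show ?thesis
        using plT1 True unfolding T_def placement_def by (simp add: inj_on_insert) blast
    next
      case False
      then show ?thesis using plT1 by (simp add: T_def)
    qed
    have new: "no_chain3 r (T \<inter> box (Suc i) (Suc j)) \<and> label q (T \<inter> box (Suc i) (Suc j)) =
      s (Suc i) (Suc j)"
      by (rule label_retract)
        (use pl avT small adm gr retract memT labs in \<open>auto simp: sub intro: placement_subset\<close>)
    have fill: "filling r q F s T"
      unfolding filling_def board_avoids_def
    proof (intro conjI allI impI)
      show "T \<subseteq> F" using T1F ij(1) by (auto simp: T_def F'_def)
      show "placement T" by (rule pl)
    next
      fix x y assume "box x y \<subseteq> F"
      then show "no_chain3 r (T \<inter> box x y)"
        using avT[of x y] big[of x y] new unfolding boxF' by blast
    next
      fix x y assume xy: "border F x y"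
      show "label q (T \<inter> box x y) = s x y"
      proof (cases "(x, y) = (Suc i, Suc j)")
        case True
        then show ?thesis using new by simp
      next
        case False
        moreover have "(x, y) \<noteq> (i, j)" using xy ij(1) by (auto simp: border_def)
        ultimately show ?thesis using labT[of x y] xy border'[of x y] by (auto simp: s'_def)
      qed
    qed
    show ?thesis
    proof (rule ex1I[of _ T])
      show "filling r q F s T" by (rule fill)
    next
      fix T' assume "filling r q F s T'"
      then have "filling r q F' s' (T' - {(i, j)})" "(i, j) \<in> T' \<longleftrightarrow> b" using down by blast+
      then have "T' - {(i, j)} = T - {(i, j)}" "(i, j) \<in> T' \<longleftrightarrow> (i, j) \<in> T"
        using ex1 T1 TT1 memT by blast+
      then show "T' = T" by blast
    qed
  qed
qed

definition same_labels :: "(nat \<times> nat \<Rightarrow> nat \<times> nat \<Rightarrow> bool) \<Rightarrow> (nat \<times> nat \<Rightarrow> nat \<times> nat \<Rightarrow> bool) \<Rightarrow>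
    (nat \<times> nat) set \<Rightarrow> (nat \<times> nat) set \<Rightarrow> (nat \<times> nat) set \<Rightarrow> bool"
  where "same_labels q q' F T T' \<longleftrightarrow>
    (\<forall>a b. border F a b \<longrightarrow> label q (T \<inter> box a b) = label q' (T' \<inter> box a b))"

text \<open>The labels of \<open>T\<close> under the first rule satisfy
  \<open>border_labels\<close>, so exactly one filling for the second rule has them.\<close>

lemma exchange_unique:
  assumes "growth_rule r q g" "growth_rule r' q' g'"
    and "finite F" "down_closed F" "placement T" "board_avoids r F T"
  shows "\<exists>!T'. T' \<subseteq> F \<and> placement T' \<and> board_avoids r' F T' \<and> same_labels q q' F T T'"
proof -
  have "border_labels F (\<lambda>a b. label q (T \<inter> box a b))"
    using assms by (intro growth_rule.border_labels_label)
  from growth_rule.unique_filling[OF assms(2-4) this]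
  show ?thesis unfolding filling_def same_labels_def by metis
qed

section \<open>Symmetric permutations\<close>

definition below :: "(nat \<times> nat) set \<Rightarrow> (nat \<times> nat) set"
  where "below P = {c. \<exists>p\<in>P. ne c p}"

text \<open>\<open>t\<close> stands for the letter 4 ending both patterns; \<open>r\<close> fixes
  the order of the other three.\<close>

definition avoids_capped :: "(nat \<times> nat \<Rightarrow> nat \<times> nat \<Rightarrow> bool) \<Rightarrow> (nat \<times> nat) set \<Rightarrow> bool"
  where "avoids_capped r P \<longleftrightarrow>
    \<not> (\<exists>p\<in>P. \<exists>q\<in>P. \<exists>s\<in>P. \<exists>t\<in>P. r p q \<and> r q s \<and> ne p t \<and> ne q t \<and> ne s t)"

lemma below_trans: "ne c p \<Longrightarrow> p \<in> below P \<Longrightarrow> c \<in> below P"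
  unfolding below_def ne_def by (simp, meson less_trans)

lemma down_closed_below: "down_closed (below P)"
  unfolding down_closed_def below_def ne_def by (simp, meson le_less_trans)

lemma finite_below:
  assumes "finite P"
  shows "finite (below P)"
proof (rule finite_subset)
  show "below P \<subseteq> (\<Union>p\<in>P. box (fst p) (snd p))"
    by (auto simp: below_def ne_def)
qed (use assms in auto)

text \<open>The top right cell of a nonempty rectangle in the board has a point \<open>t\<close> of
  \<open>P\<close> to its north-east, and \<open>t\<close> caps every chain in the rectangle.
  Conversely, the rectangle south-west of \<open>t\<close> lies in the board.\<close>

lemma avoids_capped_iff: "avoids_capped r P \<longleftrightarrow> board_avoids r (below P) (P \<inter> below P)"
proof
  assume av: "avoids_capped r P"
  show "board_avoids r (below P) (P \<inter> below P)"
    unfolding board_avoids_def no_chain3_def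
  proof (intro allI impI notI)
    fix a b
    assume box: "box a b \<subseteq> below P"
      and "\<exists>p\<in>P \<inter> below P \<inter> box a b. \<exists>q\<in>P \<inter> below P \<inter> box a b.
        \<exists>s\<in>P \<inter> below P \<inter> box a b. r p q \<and> r q s"
    then obtain p q s where pqs: "p \<in> P" "q \<in> P" "s \<in> P" "r p q" "r q s"
      and inb: "p \<in> box a b" "q \<in> box a b" "s \<in> box a b" by blast
    then have "a \<noteq> 0" "b \<noteq> 0" by (auto simp: box_def)
    then have "(a - 1, b - 1) \<in> below P" using box by (auto simp: box_def)
    then obtain t where t: "t \<in> P" "a - 1 < fst t" "b - 1 < snd t" by (auto simp: below_def ne_def)
    then have "ne u t" if "u \<in> box a b" for u
      using that by (auto simp: ne_def box_def)
    then show False using av pqs inb t(1) unfolding avoids_capped_def by blast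
  qed
next
  assume av: "board_avoids r (below P) (P \<inter> below P)"
  show "avoids_capped r P"
    unfolding avoids_capped_def
  proof
    assume "\<exists>p\<in>P. \<exists>q\<in>P. \<exists>s\<in>P. \<exists>t\<in>P. r p q \<and> r q s \<and> ne p t \<and> ne q t \<and> ne s t"
    then obtain p q s t where *: "p \<in> P" "q \<in> P" "s \<in> P" "t \<in> P" "r p q" "r q s" "ne p t" "ne q t" "ne s t"
      by blast
    have "box (fst t) (snd t) \<subseteq> below P"
      using *(4) by (auto simp: below_def ne_def)
    then have no: "no_chain3 r (P \<inter> below P \<inter> box (fst t) (snd t))"
      using av by (simp add: board_avoids_def)
    have "u \<in> P \<inter> below P \<inter> box (fst t) (snd t)" if "u \<in> P" "ne u t" for u
      using that *(4) by (cases u) (auto simp: below_def ne_def)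
    then show False using no * unfolding no_chain3_def by blast
  qed
qed

lemma below_Un: "below (A \<union> B) = below A \<union> below B"
  by (auto simp: below_def)

lemma below_subset: "A \<subseteq> below B \<Longrightarrow> below A \<subseteq> below B"
  using below_trans unfolding below_def[of A] by blast

text \<open>Among the points north-east of a cell, one with the largest coordinate sum is outside
  the board. So the board survives when the points inside it are replaced.\<close>

lemma below_maximal:
  assumes "finite P"
  shows "below (P - below P) = below P"
proof
  show "below (P - below P) \<subseteq> below P" by (auto simp: below_def)
  show "below P \<subseteq> below (P - below P)"
  proof
    fix c assume "c \<in> below P"
    then obtain p where p: "p \<in> P" "ne c p" by (auto simp: below_def)
    define U where "U = {u \<in> P. ne c u}"
    define f where "f = (\<lambda>u::nat \<times> nat. fst u + snd u)"
    have U: "finite U" "U \<noteq> {}" using assms p unfolding U_def by (simp, blast)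
    then have "Max (f ` U) \<in> f ` U" by (intro Max_in) auto
    then obtain m where m: "m \<in> U" "Max (f ` U) = f m" by auto
    have le: "f u \<le> f m" if "u \<in> U" for u
      using that U(1) m(2)[symmetric] by simp
    have "m \<notin> below P"
    proof
      assume "m \<in> below P"
      then obtain u where u: "u \<in> P" "ne m u" by (auto simp: below_def)
      then have "u \<in> U" using m(1) by (auto simp: U_def ne_def)
      then show False using le[of u] u(2) by (simp add: f_def ne_def)
    qed
    then show "c \<in> below (P - below P)" using m(1) by (auto simp: U_def below_def)
  qed
qed

text \<open>At the top of column \<open>a\<close>, the first components of the labels of two neighbouring border vertices
  tell whether the column is occupied.\<close>

lemma same_labels_columns:
  assumes "finite F" "down_closed F" "T \<subseteq> F" "T' \<subseteq> F" "same_labels q q' F T T'"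
  shows "fst ` T = fst ` T'"
proof -
  have "a \<in> fst ` T \<longleftrightarrow> a \<in> fst ` T'" for a
  proof -
    have "inj (Pair a)" by (simp add: inj_on_def)
    then have "finite (Pair a -` F)" using assms(1) by (rule finite_vimageI[rotated])
    then obtain b0 where "(a, b0) \<notin> F"
      using infinite_UNIV_nat by (metis UNIV_eq_I vimageI2 ex_new_if_finite)
    \<comment> \<open>\<open>b\<close> is the height of column \<open>a\<close>; at this height the
      vertices on both sides of the column are on the border.\<close>
    define b where "b = (LEAST b. (a, b) \<notin> F)"
    have b: "(a, b) \<notin> F" unfolding b_def by (rule LeastI) (fact \<open>(a, b0) \<notin> F\<close>)
    have b': "(a, y) \<in> F \<longleftrightarrow> y < b" for y
      using not_less_Least[of y "\<lambda>b. (a, b) \<notin> F"] b down_closedD[OF assms(2), of a y a b]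
      unfolding b_def[symmetric] by (metis not_le order_refl)
    have "box (Suc a) b \<subseteq> F"
    proof
      fix c assume "c \<in> box (Suc a) b"
      then obtain x y where "c = (x, y)" "x \<le> a" "y < b" by (cases c) auto
      then show "c \<in> F" using down_closedD[OF assms(2), of a y x y] b' by simp
    qed
    moreover have "(Suc a, b) \<notin> F" using b down_closedD[OF assms(2), of "Suc a" b a b] by auto
    moreover have "box a b \<subseteq> box (Suc a) b" by auto
    ultimately have bor: "border F a b" "border F (Suc a) b" using b by (auto simp: border_def)
    have col: "a \<in> fst ` S \<longleftrightarrow> card (S \<inter> box a b) \<noteq> card (S \<inter> box (Suc a) b)" if "S \<subseteq> F" for S
    proof
      assume "a \<in> fst ` S"
      then obtain y where y: "(a, y) \<in> S" by auto
      then have "y < b" using that b' by blast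
      then have "(a, y) \<in> S \<inter> box (Suc a) b" "(a, y) \<notin> S \<inter> box a b" using y by auto
      moreover have "S \<inter> box a b \<subseteq> S \<inter> box (Suc a) b" by auto
      ultimately have "S \<inter> box a b \<subset> S \<inter> box (Suc a) b" by blast
      then show "card (S \<inter> box a b) \<noteq> card (S \<inter> box (Suc a) b)"
        by (metis finite_Int finite_box psubset_card_mono nat_neq_iff)
    next
      assume *: "card (S \<inter> box a b) \<noteq> card (S \<inter> box (Suc a) b)"
      show "a \<in> fst ` S"
      proof (rule ccontr)
        assume "a \<notin> fst ` S"
        then have "S \<inter> box a b = S \<inter> box (Suc a) b" by (force simp: less_Suc_eq)
        then show False using * by simp
      qed
    qed
    show ?thesis
      unfolding col[OF assms(3)] col[OF assms(4)]
      using assms(5) bor unfolding same_labels_def label_def by auto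
  qed
  then show ?thesis by blast
qed

section \<open>Reflection in the diagonal\<close>

definition flip :: "(nat \<times> nat) set \<Rightarrow> (nat \<times> nat) set"
  where "flip S = prod.swap ` S"

text \<open>Reflection preserves \<open>ne\<close> and reverses \<open>se\<close>. Chains do not
  feel the reversal, so one notion covers both.\<close>

definition flippable :: "(nat \<times> nat \<Rightarrow> nat \<times> nat \<Rightarrow> bool) \<Rightarrow> bool"
  where "flippable r \<longleftrightarrow> (\<forall>p q. r (prod.swap p) (prod.swap q) = r p q) \<or>
    (\<forall>p q. r (prod.swap p) (prod.swap q) = r q p)"

lemma flippable_ne: "flippable ne" and flippable_se: "flippable se"
  by (auto simp: flippable_def ne_def se_def)

lemma in_flip [simp]: "(a, b) \<in> flip S \<longleftrightarrow> (b, a) \<in> S"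
  by (force simp: flip_def)

lemma flip_flip [simp]: "flip (flip S) = S"
  by auto

lemma flip_mono: "S \<subseteq> T \<Longrightarrow> flip S \<subseteq> flip T"
  by (auto simp: flip_def)

lemma flip_box [simp]: "flip (box a b) = box b a"
  by auto

lemma flip_Int: "flip (S \<inter> T) = flip S \<inter> flip T"
  by auto

lemma flip_Un: "flip (S \<union> T) = flip S \<union> flip T"
  by auto

lemma flip_Diff: "flip (S - T) = flip S - flip T"
  by auto

lemma fst_flip: "fst ` flip S = snd ` S"
  by (force simp: flip_def)

lemma below_flip: "below (flip P) = flip (below P)"
  by (force simp: below_def ne_def flip_def)

lemma placement_flip: "placement S \<Longrightarrow> placement (flip S)"
  unfolding placement_def inj_on_def flip_def by auto

lemma chain_flip: "flippable r \<Longrightarrow> chain r S \<Longrightarrow> chain r (flip S)"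
  unfolding flippable_def chain_def flip_def by (metis (no_types, lifting) imageE)

lemma no_chain3_flip: "flippable r \<Longrightarrow> no_chain3 r S \<Longrightarrow> no_chain3 r (flip S)"
  unfolding flippable_def no_chain3_def flip_def by (metis (no_types, lifting) imageE)

lemma card_flip: "card (flip S) = card S"
  unfolding flip_def by (intro card_image) (auto simp: inj_on_def)

lemma finite_flip: "finite S \<Longrightarrow> finite (flip S)"
  by (simp add: flip_def)

lemma max_chain_flip:
  assumes "flippable r" "finite S"
  shows "max_chain r (flip S) = max_chain r S"
proof -
  have le: "max_chain r U \<le> max_chain r (flip U)" if "finite U" for U
  proof -
    obtain C where C: "C \<subseteq> U" "chain r C" "card C = max_chain r U" "finite C"
      using \<open>finite U\<close> by (rule max_chain_attained)
    have "card (flip C) \<le> max_chain r (flip U)"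
      by (intro card_le_max_chain finite_flip flip_mono chain_flip that C assms(1))
    then show ?thesis using C(3) by (simp add: card_flip)
  qed
  show ?thesis
    using le[OF assms(2)] le[OF finite_flip[OF assms(2)]] by simp
qed

lemma label_flip: "flippable r \<Longrightarrow> finite S \<Longrightarrow> label r (flip S) = label r S"
  by (simp add: label_def max_chain_flip card_flip)

lemma box_subset_flip: "flip F = F \<Longrightarrow> box b a \<subseteq> F \<longleftrightarrow> box a b \<subseteq> F"
  using flip_mono[of "box a b" F] flip_mono[of "box b a" F] by auto

lemma same_labels_flip:
  assumes "flippable q" "flippable q'" "flip F = F" "same_labels q q' F T T'"
  shows "same_labels q q' F (flip T) (flip T')"
  unfolding same_labels_def
proof (intro allI impI)
  fix a b assume "border F a b"
  then have "border F b a"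
    using box_subset_flip[OF assms(3)] assms(3) unfolding border_def by (metis in_flip)
  then have "label q (T \<inter> box b a) = label q' (T' \<inter> box b a)"
    using assms(4) by (simp add: same_labels_def)
  then have "label q (flip (T \<inter> box b a)) = label q' (flip (T' \<inter> box b a))"
    using assms(1,2) by (simp add: label_flip)
  then show "label q (flip T \<inter> box a b) = label q' (flip T' \<inter> box a b)"
    by (simp add: flip_Int)
qed

lemma board_avoids_flip:
  assumes "flippable r" "flip F = F" "board_avoids r F T"
  shows "board_avoids r F (flip T)"
  unfolding board_avoids_def
proof (intro allI impI)
  fix a b assume "box a b \<subseteq> F"
  then have "no_chain3 r (T \<inter> box b a)"
    using assms(3) box_subset_flip[OF assms(2)] unfolding board_avoids_def by metis
  from no_chain3_flip[OF assms(1) this] show "no_chain3 r (flip T \<inter> box a b)"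
    by (simp add: flip_Int)
qed

lemma same_labels_sym: "same_labels q q' F T T' \<Longrightarrow> same_labels q' q F T' T"
  by (simp add: same_labels_def)

section \<open>Exchange of symmetric permutations\<close>

definition symmetric_permutations :: "(nat \<times> nat \<Rightarrow> nat \<times> nat \<Rightarrow> bool) \<Rightarrow> nat \<Rightarrow> (nat \<times> nat) set set"
  where "symmetric_permutations r n =
    {P. placement P \<and> fst ` P = {1..n} \<and> flip P = P \<and> avoids_capped r P}"

lemma finite_symmetric_permutations: "finite (symmetric_permutations r n)"
proof (rule finite_subset)
  show "symmetric_permutations r n \<subseteq> Pow ({1..n} \<times> {1..n})"
  proof
    fix P assume "P \<in> symmetric_permutations r n"
    then have "fst ` P = {1..n}" "snd ` P = {1..n}"
      using fst_flip[of P] by (auto simp: symmetric_permutations_def)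
    then have "P \<subseteq> {1..n} \<times> {1..n}" by (metis subset_fst_snd)
    then show "P \<in> Pow ({1..n} \<times> {1..n})" by blast
  qed
qed simp

lemma placement_finite:
  assumes "placement P" "finite (fst ` P)"
  shows "finite P"
  using assms finite_imageD unfolding placement_def by blast

text \<open>The points outside the board are kept; those inside are replaced by the filling with the
  same labels.\<close>

lemma exchange_symmetric:
  assumes gr: "growth_rule r q g" "growth_rule r' q' g'"
    and fl: "flippable q" "flippable r'" "flippable q'"
    and P: "P \<in> symmetric_permutations r n"
  shows "\<exists>P'\<in>symmetric_permutations r' n. below P' = below P \<and> P' - below P' = P - below P \<and>
    same_labels q q' (below P) (P \<inter> below P) (P' \<inter> below P')"
proof -
  let ?F = "below P" and ?T = "P \<inter> below P" and ?M = "P - below P"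
  have pl: "placement P" and fst: "fst ` P = {1..n}" and sw: "flip P = P" and av: "avoids_capped r P"
    using P by (auto simp: symmetric_permutations_def)
  have fin: "finite P" using placement_finite[OF pl] fst by simp
  note finF = finite_below[OF fin] and dcF = down_closed_below[of P]
  have swF: "flip ?F = ?F" using below_flip[of P] sw by simp
  have swT: "flip ?T = ?T" using sw swF by (simp add: flip_Int)
  have swM: "flip ?M = ?M" using sw swF by (simp add: flip_Diff)
  have plT: "placement ?T" using pl by (rule placement_subset) blast
  have "\<exists>!T'. T' \<subseteq> ?F \<and> placement T' \<and> board_avoids r' ?F T' \<and> same_labels q q' ?F ?T T'"
    using av by (intro exchange_unique[OF gr finF dcF plT]) (simp add: avoids_capped_iff)
  then obtain T' where T': "T' \<subseteq> ?F" "placement T'" "board_avoids r' ?F T'" "same_labels q q' ?F ?T T'"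
    and uniq: "\<And>U. \<lbrakk>U \<subseteq> ?F; placement U; board_avoids r' ?F U; same_labels q q' ?F ?T U\<rbrakk> \<Longrightarrow> U = T'"
    by metis
  \<comment> \<open>\<open>flip T'\<close> meets all conditions that determine \<open>T'\<close>,
    since \<open>?T\<close>, whose labels are to be matched, is symmetric.\<close>
  have swT': "flip T' = T'"
    using flip_mono[OF T'(1)] same_labels_flip[OF fl(1,3) swF T'(4)]
    by (intro uniq placement_flip board_avoids_flip fl swF T'(2,3)) (simp_all add: swF swT)
  define P' where "P' = T' \<union> ?M"
  have "below T' \<subseteq> below ?M"
    using T'(1) by (intro below_subset) (simp add: below_maximal[OF fin])
  then have belowP': "below P' = below P"
    using below_maximal[OF fin] by (auto simp: P'_def below_Un)
  have inner: "P' \<inter> below P' = T'" and outer: "P' - below P' = ?M"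
    using T'(1) unfolding belowP' by (auto simp: P'_def)
  have fstT: "fst ` ?T = fst ` T'"
    using T'(1,4) by (intro same_labels_columns[OF finF dcF]) auto
  have sndT: "snd ` ?T = snd ` T'"
    using fstT swT swT' by (metis fst_flip)
  have split: "P = ?T \<union> ?M" by blast
  have disj: "fst ` ?T \<inter> fst ` ?M = {}" "snd ` ?T \<inter> snd ` ?M = {}"
    using pl unfolding placement_def inj_on_def by blast+
  \<comment> \<open>\<open>T'\<close> occupies the columns and rows of \<open>?T\<close>, which are
    disjoint from those of \<open>?M\<close>.\<close>
  have "placement P'"
    using T'(2) placement_subset[OF pl, of ?M] disj
    unfolding P'_def fstT sndT placement_def inj_on_Un by blast
  moreover have "fst ` P' = {1..n}"
    using fst split fstT unfolding P'_def by (metis image_Un)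
  moreover have "flip P' = P'" using swT' swM by (simp add: P'_def flip_Un)
  moreover have "avoids_capped r' P'"
    unfolding avoids_capped_iff inner unfolding belowP' by (rule T'(3))
  ultimately have "P' \<in> symmetric_permutations r' n" by (simp add: symmetric_permutations_def)
  then show ?thesis using belowP' inner outer T'(4) by metis
qed

text \<open>The exchange keeps the board, the outer points and the labels, so uniqueness for the
  first rule recovers the original permutation.\<close>

lemma card_symmetric_permutations_le:
  assumes gr: "growth_rule r q g" "growth_rule r' q' g'"
    and fl: "flippable q" "flippable r'" "flippable q'"
  shows "card (symmetric_permutations r n) \<le> card (symmetric_permutations r' n)"
proof -
  define R where "R P P' \<longleftrightarrow> below P' = below P \<and> P' - below P' = P - below P \<and>
    same_labels q q' (below P) (P \<inter> below P) (P' \<inter> below P')" for P P'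
  have "\<forall>P\<in>symmetric_permutations r n. \<exists>P'. P' \<in> symmetric_permutations r' n \<and> R P P'"
    using exchange_symmetric[OF gr fl] unfolding R_def by blast
  then obtain f where f: "\<And>P. P \<in> symmetric_permutations r n \<Longrightarrow> f P \<in> symmetric_permutations r' n \<and>
    R P (f P)"
    by metis
  have "inj_on f (symmetric_permutations r n)"
  proof (rule inj_onI)
    fix P1 P2
    assume P: "P1 \<in> symmetric_permutations r n" "P2 \<in> symmetric_permutations r n" "f P1 = f P2"
    define Q where "Q = f P1"
    have R: "R P1 Q" "R P2 Q" and Q: "Q \<in> symmetric_permutations r' n"
      using f[OF P(1)] f[OF P(2)] P(3) by (auto simp: Q_def)
    have plQ: "placement Q" and "fst ` Q = {1..n}" and avQ: "avoids_capped r' Q"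
      using Q by (auto simp: symmetric_permutations_def)
    then have fin: "finite Q" using placement_finite by simp
    have "\<exists>!T. T \<subseteq> below Q \<and> placement T \<and> board_avoids r (below Q) T \<and>
        same_labels q' q (below Q) (Q \<inter> below Q) T"
      using avQ placement_subset[OF plQ]
      by (intro exchange_unique[OF gr(2,1) finite_below[OF fin] down_closed_below]) (auto simp:
        avoids_capped_iff)
    moreover have "P \<inter> below Q \<subseteq> below Q \<and> placement (P \<inter> below Q) \<and>
      board_avoids r (below Q) (P \<inter> below Q) \<and>
        same_labels q' q (below Q) (Q \<inter> below Q) (P \<inter> below Q)"
      if "P \<in> symmetric_permutations r n" "R P Q" for P
      using that placement_subset[of P "P \<inter> below Q"]
      by (auto simp: symmetric_permutations_def R_def avoids_capped_iff same_labels_sym)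
    ultimately have "P1 \<inter> below Q = P2 \<inter> below Q" using P R by metis
    moreover have "P1 - below Q = P2 - below Q" using R by (auto simp: R_def)
    ultimately show "P1 = P2" by blast
  qed
  then show ?thesis
    using f by (intro card_inj_on_le[OF _ _ finite_symmetric_permutations]) auto
qed

section \<open>From one-line notation to graphs of involutions\<close>

lemma subseq_one_line:
  "subseq w (one_line n \<pi>) \<longleftrightarrow> (\<exists>xs. sorted_wrt (<) xs \<and> set xs \<subseteq> {1..n} \<and> w = map \<pi> xs)"
proof
  assume "subseq w (one_line n \<pi>)"
  then obtain N where N: "w = map \<pi> (nths [1..<Suc n] N)"
    by (auto simp: subseq_conv_nths one_line_def nths_map simp del: upt_Suc)
  have "sorted_wrt (<) (nths [1..<Suc n] N)"
    using strict_sorted_iff by (metis distinct_nthsI distinct_upt sorted_nths sorted_upt)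
  moreover have "set (nths [1..<Suc n] N) \<subseteq> {1..n}"
    using set_nths_subset[of "[1..<Suc n]" N] by (auto simp del: upt_Suc)
  ultimately show "\<exists>xs. sorted_wrt (<) xs \<and> set xs \<subseteq> {1..n} \<and> w = map \<pi> xs"
    using N by blast
next
  assume "\<exists>xs. sorted_wrt (<) xs \<and> set xs \<subseteq> {1..n} \<and> w = map \<pi> xs"
  then obtain xs where xs: "sorted_wrt (<) xs" "set xs \<subseteq> {1..n}" "w = map \<pi> xs" by blast
  have "set xs \<subseteq> set [1..<Suc n]" using xs(2) by (auto simp del: upt_Suc)
  then have "subseq xs [1..<Suc n]"
    using xs(1) sorted_upt by (rule sorted_subset_imp_subseq)
  then show "subseq w (one_line n \<pi>)"
    unfolding one_line_def xs(3) by (rule subseq_map)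
qed

text \<open>Monotonicity of \<open>f\<close> carries strict inequalities between the prescribed
  values back to the letters.\<close>

lemma relabel_4E:
  assumes "relabel w = [k1, k2, k3, k4]"
  obtains a b c d and f :: "nat \<Rightarrow> nat" where "w = [a, b, c, d]" "mono f" "f a = k1" "f b = k2"
    "f c = k3" "f d = k4"
proof -
  have "length w = 4" using arg_cong[OF assms, of length] by (simp add: relabel_def)
  then obtain a b c d where w: "w = [a, b, c, d]"
    by (auto simp: numeral_eq_Suc length_Suc_conv)
  have "mono (\<lambda>v. card {u \<in> set w. u \<le> v})"
    by (intro monoI card_mono) auto
  then show ?thesis using that[OF w] assms unfolding relabel_def by (simp add: w)
qed

lemma relabel_1234_iff:
  "relabel w = [1, 2, 3, 4] \<longleftrightarrow> (\<exists>a b c d. w = [a, b, c, d] \<and> a < b \<and> b < c \<and> c < d)"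
proof
  assume "relabel w = [1, 2, 3, 4]"
  then obtain a b c d and f :: "nat \<Rightarrow> nat" where w: "w = [a, b, c, d]" and f: "mono f" "f a = 1"
    "f b = 2" "f c = 3" "f d = 4"
    by (rule relabel_4E)
  have "a < b" "b < c" "c < d"
    using monoD[OF f(1), of b a] monoD[OF f(1), of c b] monoD[OF f(1), of d c] f
      by (auto simp: not_le[symmetric])
  with w show "\<exists>a b c d. w = [a, b, c, d] \<and> a < b \<and> b < c \<and> c < d" by blast
next
  assume "\<exists>a b c d. w = [a, b, c, d] \<and> a < b \<and> b < c \<and> c < d"
  then obtain a b c d where w: "w = [a, b, c, d]" and l: "a < b" "b < c" "c < d" by blast
  have "{u \<in> set w. u \<le> a} = {a}" "{u \<in> set w. u \<le> b} = {a, b}" "{u \<in> set w. u \<le> c} = {a, b, c}"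
    "{u \<in> set w. u \<le> d} = {a, b, c, d}"
    using l by (auto simp: w)
  then show "relabel w = [1, 2, 3, 4]"
    using l by (simp add: relabel_def w)
qed

lemma relabel_3214_iff:
  "relabel w = [3, 2, 1, 4] \<longleftrightarrow> (\<exists>a b c d. w = [a, b, c, d] \<and> c < b \<and> b < a \<and> a < d)"
proof
  assume "relabel w = [3, 2, 1, 4]"
  then obtain a b c d and f :: "nat \<Rightarrow> nat" where w: "w = [a, b, c, d]" and f: "mono f" "f a = 3"
    "f b = 2" "f c = 1" "f d = 4"
    by (rule relabel_4E)
  have "c < b" "b < a" "a < d"
    using monoD[OF f(1), of b c] monoD[OF f(1), of a b] monoD[OF f(1), of d a] f
      by (auto simp: not_le[symmetric])
  with w show "\<exists>a b c d. w = [a, b, c, d] \<and> c < b \<and> b < a \<and> a < d" by blast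
next
  assume "\<exists>a b c d. w = [a, b, c, d] \<and> c < b \<and> b < a \<and> a < d"
  then obtain a b c d where w: "w = [a, b, c, d]" and l: "c < b" "b < a" "a < d" by blast
  have "{u \<in> set w. u \<le> c} = {c}" "{u \<in> set w. u \<le> b} = {b, c}" "{u \<in> set w. u \<le> a} = {a, b, c}"
    "{u \<in> set w. u \<le> d} = {a, b, c, d}"
    using l by (auto simp: w)
  then show "relabel w = [3, 2, 1, 4]"
    using l by (simp add: relabel_def w)
qed

definition perm_graph :: "nat \<Rightarrow> (nat \<Rightarrow> nat) \<Rightarrow> (nat \<times> nat) set"
  where "perm_graph n \<pi> = (\<lambda>i. (i, \<pi> i)) ` {1..n}"

lemma avoids_iff_quadruples:
  assumes "\<And>w. relabel w = \<sigma> \<longleftrightarrow> (\<exists>a b c d. w = [a, b, c, d] \<and> P a b c d)"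
  shows "avoids n \<pi> \<sigma> \<longleftrightarrow>
    \<not> (\<exists>i\<in>{1..n}. \<exists>j\<in>{1..n}. \<exists>k\<in>{1..n}. \<exists>l\<in>{1..n}. i < j \<and> j < k \<and> k < l \<and> P (\<pi> i) (\<pi> j) (\<pi> k) (\<pi> l))"
proof -
  let ?Q = "\<exists>i\<in>{1..n}. \<exists>j\<in>{1..n}. \<exists>k\<in>{1..n}. \<exists>l\<in>{1..n}.
    i < j \<and> j < k \<and> k < l \<and> P (\<pi> i) (\<pi> j) (\<pi> k) (\<pi> l)"
  have "?Q" if w: "subseq w (one_line n \<pi>)" "relabel w = \<sigma>" for w
  proof -
    obtain xs where xs: "sorted_wrt (<) xs" "set xs \<subseteq> {1..n}" "w = map \<pi> xs"
      using w(1) unfolding subseq_one_line by blast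
    obtain a b c d where abcd: "w = [a, b, c, d]" and P: "P a b c d"
      using w(2) unfolding assms by blast
    have "length xs = 4" using arg_cong[OF xs(3), of length] abcd by simp
    then obtain i j k l where "xs = [i, j, k, l]"
      by (auto simp: numeral_eq_Suc length_Suc_conv)
    then have "i \<in> {1..n}" "j \<in> {1..n}" "k \<in> {1..n}" "l \<in> {1..n}" "i < j \<and> j < k \<and> k < l"
      "P (\<pi> i) (\<pi> j) (\<pi> k) (\<pi> l)"
      using xs abcd P by simp_all
    then show ?thesis by blast
  qed
  moreover have "\<exists>w. subseq w (one_line n \<pi>) \<and> relabel w = \<sigma>" if ?Q
  proof -
    obtain i j k l where *: "i \<in> {1..n}" "j \<in> {1..n}" "k \<in> {1..n}" "l \<in> {1..n}" "i < j" "j < k" "k < l"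
      "P (\<pi> i) (\<pi> j) (\<pi> k) (\<pi> l)"
      using \<open>?Q\<close> by blast
    have "subseq (map \<pi> [i, j, k, l]) (one_line n \<pi>)"
      unfolding subseq_one_line using * by (intro exI[of _ "[i, j, k, l]"]) auto
    moreover have "relabel (map \<pi> [i, j, k, l]) = \<sigma>"
      unfolding assms using *(8) by simp
    ultimately show ?thesis by blast
  qed
  ultimately show ?thesis unfolding avoids_def by blast
qed

lemma avoids_1234_iff: "avoids n \<pi> [1, 2, 3, 4] \<longleftrightarrow> avoids_capped ne (perm_graph n \<pi>)"
  unfolding avoids_iff_quadruples[OF relabel_1234_iff] avoids_capped_def perm_graph_def ne_def
    bex_simps image_iff
  by simp (meson less_trans)

lemma avoids_3214_iff: "avoids n \<pi> [3, 2, 1, 4] \<longleftrightarrow> avoids_capped se (perm_graph n \<pi>)"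
  unfolding avoids_iff_quadruples[OF relabel_3214_iff] avoids_capped_def perm_graph_def ne_def se_def
  by simp (meson less_trans)

lemma bij_betw_perm_graph:
  assumes "\<And>\<pi>. avoids n \<pi> \<sigma> \<longleftrightarrow> avoids_capped r (perm_graph n \<pi>)"
  shows "bij_betw (perm_graph n) (avoiding_involutions n \<sigma>) (symmetric_permutations r n)"
  unfolding bij_betw_def
proof
  have in_graph: "(x, y) \<in> perm_graph n \<pi> \<longleftrightarrow> x \<in> {1..n} \<and> y = \<pi> x" for x y \<pi>
    by (auto simp: perm_graph_def)
  show "inj_on (perm_graph n) (avoiding_involutions n \<sigma>)"
  proof (rule inj_onI, rule ext)
    fix \<pi> \<rho> x
    assume "\<pi> \<in> avoiding_involutions n \<sigma>" "\<rho> \<in> avoiding_involutions n \<sigma>"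
      and eq: "perm_graph n \<pi> = perm_graph n \<rho>"
    then have "\<pi> permutes {1..n}" "\<rho> permutes {1..n}" by (auto simp: avoiding_involutions_def)
    then show "\<pi> x = \<rho> x"
      using in_graph[of x "\<pi> x" \<pi>] in_graph[of x "\<pi> x" \<rho>] eq permutes_not_in by metis
  qed
  show "perm_graph n ` avoiding_involutions n \<sigma> = symmetric_permutations r n"
  proof
    show "perm_graph n ` avoiding_involutions n \<sigma> \<subseteq> symmetric_permutations r n"
    proof
      fix P assume "P \<in> perm_graph n ` avoiding_involutions n \<sigma>"
      then obtain \<pi> where \<pi>: "\<pi> permutes {1..n}" "\<pi> \<circ> \<pi> = id" "avoids n \<pi> \<sigma>" and P: "P = perm_graph n \<pi>"
        by (auto simp: avoiding_involutions_def)
      have inv: "\<pi> (\<pi> x) = x" for x using \<pi>(2) by (metis comp_apply id_apply)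
      have "placement P"
        using permutes_inj[OF \<pi>(1)] by (auto simp: P perm_graph_def placement_def inj_on_def)
      moreover have "fst ` P = {1..n}" by (force simp: P perm_graph_def)
      moreover have "(a, b) \<in> flip P \<longleftrightarrow> (a, b) \<in> P" for a b
        unfolding P in_flip in_graph using permutes_in_image[OF \<pi>(1)] inv by metis
      then have "flip P = P" by auto
      ultimately show "P \<in> symmetric_permutations r n"
        using assms \<pi>(3) by (simp add: symmetric_permutations_def P)
    qed
    show "symmetric_permutations r n \<subseteq> perm_graph n ` avoiding_involutions n \<sigma>"
    proof
      fix P assume "P \<in> symmetric_permutations r n"
      then have pl: "placement P" and fst: "fst ` P = {1..n}" and sw: "flip P = P" and av:
        "avoids_capped r P"
        by (auto simp: symmetric_permutations_def)
      have "\<exists>\<pi>. \<forall>x. x \<in> {1..n} \<longrightarrow> (x, \<pi> x) \<in> P"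
        using fst by (intro choice) force
      then obtain \<rho> where \<rho>: "(x, \<rho> x) \<in> P" if "x \<in> {1..n}" for x by blast
      \<comment> \<open>Outside \<open>{1..n}\<close> the identity is chosen, as
        \<open>permutes\<close> demands.\<close>
      define \<pi> where "\<pi> x = (if x \<in> {1..n} then \<rho> x else x)" for x
      have mem: "(x, y) \<in> P \<longleftrightarrow> x \<in> {1..n} \<and> y = \<pi> x" for x y
        using \<rho>[of x] placement_fstD[OF pl, of x y "\<rho> x"] fst by (force simp: \<pi>_def)
      have sym: "(x, y) \<in> P \<longleftrightarrow> (y, x) \<in> P" for x y using sw in_flip by metis
      have inv: "\<pi> (\<pi> x) = x" for x
      proof (cases "x \<in> {1..n}")
        case True
        then show ?thesis using mem sym by metis
      next
        case False
        then show ?thesis unfolding \<pi>_def by (simp only: if_False)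
      qed
      have "\<pi> permutes {1..n}"
        unfolding permutes_def
      proof (intro conjI allI impI)
        fix x assume "x \<notin> {1..n}"
        then show "\<pi> x = x" unfolding \<pi>_def by (simp only: if_False)
      next
        fix y show "\<exists>!x. \<pi> x = y" by (rule ex1I[of _ "\<pi> y"]) (use inv in auto)
      qed
      moreover have "perm_graph n \<pi> = P" using in_graph mem by auto
      ultimately have "\<pi> \<in> avoiding_involutions n \<sigma>"
        using inv av assms by (auto simp: avoiding_involutions_def)
      then show "P \<in> perm_graph n ` avoiding_involutions n \<sigma>"
        using \<open>perm_graph n \<pi> = P\<close> by blast
    qed
  qed
qed

theorem corollary6p2:
  shows "[1, 2, 3, 4] \<sim>\<^sub>I [3, 2, 1, 4]"
  unfolding invol_equiv_def
proof
  fix n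
  have "card (avoiding_involutions n [1, 2, 3, 4]) = card (symmetric_permutations ne n)"
    using bij_betw_perm_graph[OF avoids_1234_iff] by (rule bij_betw_same_card)
  \<comment> \<open>The two inequalities come from interchanging the rules;
    \<open>growth_rule_ne\<close> belongs to avoidance of \<open>se\<close>-chains and
    \<open>growth_rule_se\<close> to avoidance of \<open>ne\<close>-chains.\<close>
  also have "\<dots> = card (symmetric_permutations se n)"
    using growth_rule_ne growth_rule_se flippable_ne flippable_se
    by (intro antisym card_symmetric_permutations_le)
  also have "\<dots> = card (avoiding_involutions n [3, 2, 1, 4])"
    using bij_betw_perm_graph[OF avoids_3214_iff] by (rule bij_betw_same_card[symmetric])
  finally show "card (avoiding_involutions n [1, 2, 3, 4]) = card (avoiding_involutions n [3, 2, 1, 4])" .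
qed

end
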